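(* Let $S$ be a closed, connected, oriented surface of genus $g\ge 1$, let $n\ge1$, and let $\overline{\rho}:\mathrm{H}_1(S,\mathbb{Z})\to\mathbb{T}^n$ be a representation. Then the image of $\overline{\rho}$ is dense in $\mathbb{T}^n$ if and only if the symplectic group orbit $\mathrm{Sp}(2g,\mathbb{Z})\cdot\overline{\rho}$ is dense in the homological representation space $\mathrm{Hom}(\mathrm{H}_1(S,\mathbb{Z}),\mathbb{T}^n)$.
   Context: $\mathbb{T}^n=(\mathbb{S}^1)^n\cong\mathbb{R}^n/2\pi\mathbb{Z}^n$. A representation is a group homomorphism. $\mathrm{Hom}(\mathrm{H}_1(S,\mathbb{Z}),\mathbb{T}^n)$ carries the compact-open topology (equivalently, after fixing a basis of $\mathrm{H}_1(S,\mathbb{Z})\cong\mathbb{Z}^{2g}$, the topology of $(\mathbb{T}^n)^{2g}$). $\mathrm{Sp}(2g,\mathbb{Z})$ is identified, via a symplectic basis, with the group of automorphisms of $\mathrm{H}_1(S,\mathbb{Z})$ preserving the algebraic intersection form, and acts by $\phi\cdot\overline{\rho}=\overline{\rho}\circ\phi^{-1}$. *)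

theory Defs
  imports "HOL-Homology.Homology"
begin

section \<open>Singular cochains of low degree and Poincare duality\<close>

definition cochain_eval :: "(((nat \<Rightarrow> real) \<Rightarrow> 'a) \<Rightarrow> int) \<Rightarrow> 'a chain \<Rightarrow> int" where
  "cochain_eval \<phi> c = (\<Sum>\<sigma>\<in>Poly_Mapping.keys c. Poly_Mapping.lookup c \<sigma> * \<phi> \<sigma>)"

definition singular_cocycle ::
    "nat \<Rightarrow> 'a topology \<Rightarrow> (((nat \<Rightarrow> real) \<Rightarrow> 'a) \<Rightarrow> int) \<Rightarrow> bool" where
  "singular_cocycle p X \<phi> \<longleftrightarrow>
     (\<forall>\<sigma>. singular_simplex (Suc p) X \<sigma> \<longrightarrow>
        cochain_eval \<phi> (chain_boundary (Suc p) (frag_of \<sigma>)) = 0)"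

text \<open>
  For a 2-simplex with vertices \<open>v0, v1, v2\<close>, the face omitting \<open>v2\<close> is the front edge
  \<open>[v0,v1]\<close> and the face omitting \<open>v0\<close> is the back edge \<open>[v1,v2]\<close>.
\<close>

definition cup11 ::
    "(((nat \<Rightarrow> real) \<Rightarrow> 'a) \<Rightarrow> int) \<Rightarrow> (((nat \<Rightarrow> real) \<Rightarrow> 'a) \<Rightarrow> int) \<Rightarrow>
     ((nat \<Rightarrow> real) \<Rightarrow> 'a) \<Rightarrow> int" where
  "cup11 \<phi> \<psi> = (\<lambda>\<sigma>. \<phi> (singular_face 2 2 \<sigma>) * \<psi> (singular_face 2 0 \<sigma>))"

definition cap21 :: "'a chain \<Rightarrow> (((nat \<Rightarrow> real) \<Rightarrow> 'a) \<Rightarrow> int) \<Rightarrow> 'a chain" where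
  "cap21 c \<phi> =
     frag_extend (\<lambda>\<sigma>. frag_cmul (\<phi> (singular_face 2 2 \<sigma>)) (frag_of (singular_face 2 0 \<sigma>))) c"


section \<open>Closed connected oriented surfaces\<close>

definition closed_connected_surface :: "'a topology \<Rightarrow> bool" where
  "closed_connected_surface S \<longleftrightarrow>
     compact_space S \<and> connected_space S \<and> Hausdorff_space S \<and>
     (\<forall>x\<in>topspace S. \<exists>U. openin S U \<and> x \<in> U \<and>
        subtopology S U homeomorphic_space Euclidean_space 2)"

text \<open>
  An orientation of \<open>S\<close> is given by its fundamental class: a class in degree 2 that
  restricts to a generator of the local homology group at every point.
\<close>

definition fundamental_class :: "'a topology \<Rightarrow> 'a chain set \<Rightarrow> bool" where
  "fundamental_class S \<mu> \<longleftrightarrow>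
     \<mu> \<in> carrier (homology_group 2 S) \<and>
     (\<forall>x\<in>topspace S.
        carrier (subgroup_generated (relative_homology_group 2 S (topspace S - {x}))
                   {hom_induced 2 S {} S (topspace S - {x}) id \<mu>})
        = carrier (relative_homology_group 2 S (topspace S - {x})))"

text \<open>
  The algebraic intersection number of \<open>x\<close> and \<open>y\<close> is the value on the fundamental class of
  the cup product of their Poincare duals. An element of a homology group is
  the set of cycles representing it, so \<open>c \<in> \<mu>\<close> says that \<open>c\<close> is a fundamental cycle. The
  relational form avoids presupposing that Poincare duals exist and that the
  value does not depend on the representatives.
\<close>

definition has_intersection_number ::
    "'a topology \<Rightarrow> 'a chain set \<Rightarrow> 'a chain set \<Rightarrow> 'a chain set \<Rightarrow> int \<Rightarrow> bool" where
  "has_intersection_number S \<mu> x y m \<longleftrightarrow>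
     (\<exists>c \<phi> \<psi>. c \<in> \<mu> \<and> singular_cocycle 1 S \<phi> \<and> singular_cocycle 1 S \<psi> \<and>
        x = homologous_rel_set 1 S {} (cap21 c \<phi>) \<and>
        y = homologous_rel_set 1 S {} (cap21 c \<psi>) \<and>
        m = cochain_eval (cup11 \<phi> \<psi>) c)"

definition intersection_form ::
    "'a topology \<Rightarrow> 'a chain set \<Rightarrow> 'a chain set \<Rightarrow> 'a chain set \<Rightarrow> int" where
  "intersection_form S \<mu> x y = (THE m. has_intersection_number S \<mu> x y m)"

definition symplectic_matrix :: "nat \<Rightarrow> nat \<Rightarrow> nat \<Rightarrow> int" where
  "symplectic_matrix g i j = (if j = i + g then 1 else if i = j + g then -1 else 0)"

definition homology_basis :: "'a topology \<Rightarrow> nat \<Rightarrow> (nat \<Rightarrow> 'a chain set) \<Rightarrow> bool" where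
  "homology_basis S r e \<longleftrightarrow>
     (\<forall>i<r. e i \<in> carrier (homology_group 1 S)) \<and>
     (\<forall>x\<in>carrier (homology_group 1 S). \<exists>!k :: nat \<Rightarrow> int. k \<in> extensional {..<r} \<and>
        x = finprod (homology_group 1 S) (\<lambda>i. e i [^]\<^bsub>homology_group 1 S\<^esub> k i) {..<r})"

definition symplectic_basis ::
    "'a topology \<Rightarrow> 'a chain set \<Rightarrow> nat \<Rightarrow> (nat \<Rightarrow> 'a chain set) \<Rightarrow> bool" where
  "symplectic_basis S \<mu> g e \<longleftrightarrow>
     homology_basis S (2 * g) e \<and>
     (\<forall>i<2*g. \<forall>j<2*g. has_intersection_number S \<mu> (e i) (e j) (symplectic_matrix g i j))"

text \<open>
  By Poincare duality and the classification of unimodular alternating forms over the integers,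
  the first homology of a closed connected oriented surface has a symplectic basis, of length
  twice the genus. The genus is taken to be half the length of such a basis; it is
  half the rank of the first homology group, hence unique, and does not depend
  on the orientation.
\<close>

definition has_genus :: "'a topology \<Rightarrow> 'a chain set \<Rightarrow> nat \<Rightarrow> bool" where
  "has_genus S \<mu> g \<longleftrightarrow> (\<exists>e. symplectic_basis S \<mu> g e)"

definition closed_oriented_surface_of_genus ::
    "'a topology \<Rightarrow> 'a chain set \<Rightarrow> nat \<Rightarrow> bool" where
  "closed_oriented_surface_of_genus S \<mu> g \<longleftrightarrow>
     closed_connected_surface S \<and> fundamental_class S \<mu> \<and> has_genus S \<mu> g"


section \<open>The torus and the homological representation space\<close>

definition torus_group :: "(complex ^ 'n) monoid" where
  "torus_group = \<lparr>carrier = {z. \<forall>i. norm (z $ i) = 1},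
                  mult = (\<lambda>z w. \<chi> i. z $ i * w $ i),
                  one = (\<chi> i. 1)\<rparr>"

definition torus_topology :: "(complex ^ 'n) topology" where
  "torus_topology = top_of_set (carrier torus_group)"

definition compact_open_topology ::
    "'a topology \<Rightarrow> 'b topology \<Rightarrow> ('a \<Rightarrow> 'b) topology" where
  "compact_open_topology X Y =
     topology_generated_by
       {{f. continuous_map X Y f \<and> f \<in> extensional (topspace X) \<and> f ` K \<subseteq> U} | K U.
          compactin X K \<and> openin Y U}"

definition rep_space :: "'a topology \<Rightarrow> ('a chain set \<Rightarrow> complex ^ 'n) set" where
  "rep_space S =
     hom (homology_group 1 S) torus_group \<inter> extensional (carrier (homology_group 1 S))"

text \<open>The homology group carries the discrete topology.\<close>

definition rep_topology :: "'a topology \<Rightarrow> ('a chain set \<Rightarrow> complex ^ 'n) topology" where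
  "rep_topology S =
     subtopology
       (compact_open_topology (discrete_topology (carrier (homology_group 1 S))) torus_topology)
       (rep_space S)"


section \<open>The action of the symplectic group\<close>

definition symplectic_group ::
    "'a topology \<Rightarrow> 'a chain set \<Rightarrow> ('a chain set \<Rightarrow> 'a chain set) set" where
  "symplectic_group S \<mu> =
     {\<phi> \<in> iso (homology_group 1 S) (homology_group 1 S).
        \<forall>x\<in>carrier (homology_group 1 S). \<forall>y\<in>carrier (homology_group 1 S).
          intersection_form S \<mu> (\<phi> x) (\<phi> y) = intersection_form S \<mu> x y}"

definition symplectic_act ::
    "'a topology \<Rightarrow> ('a chain set \<Rightarrow> 'a chain set) \<Rightarrow>
     ('a chain set \<Rightarrow> complex ^ 'n) \<Rightarrow> 'a chain set \<Rightarrow> complex ^ 'n" where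
  "symplectic_act S \<phi> \<rho> =
     compose (carrier (homology_group 1 S)) \<rho> (inv_into (carrier (homology_group 1 S)) \<phi>)"

definition symplectic_orbit ::
    "'a topology \<Rightarrow> 'a chain set \<Rightarrow> ('a chain set \<Rightarrow> complex ^ 'n) \<Rightarrow>
     ('a chain set \<Rightarrow> complex ^ 'n) set" where
  "symplectic_orbit S \<mu> \<rho> = (\<lambda>\<phi>. symplectic_act S \<phi> \<rho>) ` symplectic_group S \<mu>"

end

theory Submission
  imports Defs "HOL-Analysis.Analysis"
begin

text \<open>
  Poincare duality for cochains and the identity
  \<open>\<phi> \<union> \<psi> + \<psi> \<union> \<phi> = - \<delta>(\<phi>\<psi>)\<close> for 1-cocycles make the intersection form well defined,
  biadditive and antisymmetric, so that the statement becomes one about a symplectic lattice \<open>G\<close>.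
  The symplectic group of \<open>G\<close> contains one-parameter groups of unipotents \<open>x \<mapsto> x + k N x\<close> with
  \<open>N\<^sup>2 = 0\<close>, which move the value of a representation on one basis element by multiples of its value
  on another.

  Let the image of \<open>\<rho>\<close> be dense and let \<open>X\<close> be the orbit closure. For a nontrivial character \<open>m\<close> of the
  torus, the \<open>f \<in> X\<close> whose value at the first basis element is killed by \<open>m\<close> form a closed set with empty
  interior: some \<open>m (f e\<^sub>i)\<close> has infinite order, and a unipotent with \<open>k\<close> chosen by simultaneous
  recurrence hardly moves \<open>f\<close> but moves it out of that set. By Baire's theorem some \<open>f \<in> X\<close> sends the
  first basis element to a topological generator of the torus (Kronecker). Unipotents based at that
  element then push the remaining coordinates to any prescribed values, and one change of the pivot
  element frees the first coordinate as well.
\<close>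

section \<open>The intersection form\<close>

lemma cochain_eval_superset:
  assumes "finite A" "Poly_Mapping.keys c \<subseteq> A"
  shows "cochain_eval \<phi> c = (\<Sum>\<sigma>\<in>A. Poly_Mapping.lookup c \<sigma> * \<phi> \<sigma>)"
  unfolding cochain_eval_def
  by (rule sum.mono_neutral_left) (use assms in \<open>auto simp: in_keys_iff\<close>)

lemma cochain_eval_0 [simp]: "cochain_eval \<phi> 0 = 0"
  by (simp add: cochain_eval_def)

lemma cochain_eval_frag_of [simp]: "cochain_eval \<phi> (frag_of \<sigma>) = \<phi> \<sigma>"
  by (simp add: cochain_eval_def keys_frag_of)

lemma cochain_eval_add: "cochain_eval \<phi> (a + b) = cochain_eval \<phi> a + cochain_eval \<phi> b"
proof -
  let ?A = "Poly_Mapping.keys a \<union> Poly_Mapping.keys b"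
  have "Poly_Mapping.keys (a + b) \<subseteq> ?A"
    by (rule Poly_Mapping.keys_add)
  then show ?thesis
    by (simp add: cochain_eval_superset[of ?A] lookup_add distrib_right sum.distrib)
qed

lemma cochain_eval_cmul: "cochain_eval \<phi> (frag_cmul k a) = k * cochain_eval \<phi> a"
  by (subst cochain_eval_superset[of "Poly_Mapping.keys a" "frag_cmul k a"])
    (simp_all add: keys_cmul cochain_eval_def sum_distrib_left mult.assoc)

lemma cochain_eval_minus: "cochain_eval \<phi> (- a) = - cochain_eval \<phi> a"
  using cochain_eval_cmul[of \<phi> "-1" a] by simp

lemma cochain_eval_diff: "cochain_eval \<phi> (a - b) = cochain_eval \<phi> a - cochain_eval \<phi> b"
  using cochain_eval_add[of \<phi> a "- b"] by (simp add: cochain_eval_minus)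

lemma frag_cmul_diff: "frag_cmul k (a - b) = frag_cmul k a - frag_cmul k b"
  by (rule poly_mapping_eqI) (simp add: lookup_minus right_diff_distrib)

lemma cap21_add: "cap21 (a + b) \<phi> = cap21 a \<phi> + cap21 b \<phi>"
  by (simp add: cap21_def frag_extend_add)

lemma cap21_diff: "cap21 (a - b) \<phi> = cap21 a \<phi> - cap21 b \<phi>"
  by (simp add: cap21_def frag_extend_diff)

lemma cap21_frag_of:
  "cap21 (frag_of \<sigma>) \<phi> = frag_cmul (\<phi> (singular_face 2 2 \<sigma>)) (frag_of (singular_face 2 0 \<sigma>))"
  by (simp add: cap21_def)

lemma cap21_plus: "cap21 c (\<lambda>\<sigma>. \<phi> \<sigma> + \<psi> \<sigma>) = cap21 c \<phi> + cap21 c \<psi>"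
  by (simp add: cap21_def frag_extend_def frag_cmul_distrib frag_cmul_distrib2 sum.distrib)

lemma cap21_uminus: "cap21 c (\<lambda>\<sigma>. - \<phi> \<sigma>) = - cap21 c \<phi>"
  by (simp add: cap21_def frag_extend_def sum_negf flip: frag_cmul_minus_one)
    (simp add: sum_negf flip: minus_frag_cmul)

text \<open>The adjunction between cap and cup: on a 2-simplex both sides are the value of \<phi> on
  the front edge times the value of \<psi> on the back edge. It turns intersection numbers into
  values of a cocycle on a 1-chain, where additivity and homology invariance are at hand.\<close>

lemma cochain_eval_cap21: "cochain_eval \<psi> (cap21 c \<phi>) = cochain_eval (cup11 \<phi> \<psi>) c"
  using subset_UNIV
  by (induction c rule: frag_induction)
    (auto simp: cap21_diff cochain_eval_diff cap21_frag_of cochain_eval_cmul cup11_def cap21_def[of 0])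

section \<open>Simplicial identities and 1-cocycles\<close>

lemma singular_face_singular_face:
  assumes "1 \<le> p" "i < j" "j \<le> Suc p"
  shows "singular_face p i (singular_face (Suc p) j f) =
         singular_face p (j - 1) (singular_face (Suc p) i f)"
proof
  fix x :: "nat \<Rightarrow> real"
  have "simplical_face j (simplical_face i x) = simplical_face i (simplical_face (j - 1) x)"
    using assms by (auto simp: simplical_face_def fun_eq_iff)
  \<comment> \<open>\<open>singular_face\<close> is restricted to the standard simplex, so the inner
    face maps must land there before the identity between the maps \<open>simplical_face\<close> can
    be used.\<close>
  moreover have "simplical_face i x \<in> standard_simplex p" "simplical_face (j - 1) x \<in> standard_simplex p"
    if "x \<in> standard_simplex (p - Suc 0)"
    using that assms by (auto intro!: simplical_face_in_standard_simplex)
  ultimately show "singular_face p i (singular_face (Suc p) j f) x =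
         singular_face p (j - 1) (singular_face (Suc p) i f) x"
    by (simp add: singular_face_def)
qed

lemma chain_boundary_2:
  "chain_boundary 2 (frag_of \<sigma>) =
     frag_of (singular_face 2 0 \<sigma>) - frag_of (singular_face 2 1 \<sigma>) + frag_of (singular_face 2 2 \<sigma>)"
  by (simp add: chain_boundary_of numeral_2_eq_2)

lemma chain_boundary_3:
  "chain_boundary 3 (frag_of \<sigma>) =
     frag_of (singular_face 3 0 \<sigma>) - frag_of (singular_face 3 1 \<sigma>)
     + frag_of (singular_face 3 2 \<sigma>) - frag_of (singular_face 3 3 \<sigma>)"
  by (simp add: chain_boundary_of eval_nat_numeral)

text \<open>The cocycle condition read as additivity along the edges of a triangle. It is stated
  with \<open>Suc 0\<close>, the form into which the simplifier rewrites \<open>1\<close>.\<close>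

lemma singular_cocycle_1_iff:
  "singular_cocycle (Suc 0) X \<phi> \<longleftrightarrow>
     (\<forall>\<sigma>. singular_simplex 2 X \<sigma> \<longrightarrow>
        \<phi> (singular_face 2 (Suc 0) \<sigma>) = \<phi> (singular_face 2 2 \<sigma>) + \<phi> (singular_face 2 0 \<sigma>))"
proof -
  have "cochain_eval \<phi> (chain_boundary 2 (frag_of \<sigma>)) = 0 \<longleftrightarrow>
      \<phi> (singular_face 2 (Suc 0) \<sigma>) = \<phi> (singular_face 2 2 \<sigma>) + \<phi> (singular_face 2 0 \<sigma>)" for \<sigma>
    by (auto simp: chain_boundary_2 cochain_eval_add cochain_eval_diff)
  then show ?thesis
    by (simp add: singular_cocycle_def flip: numeral_2_eq_2)
qed

lemma singular_cocycle_1_add: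
  "singular_cocycle 1 X \<phi> \<Longrightarrow> singular_cocycle 1 X \<psi> \<Longrightarrow> singular_cocycle 1 X (\<lambda>\<sigma>. \<phi> \<sigma> + \<psi> \<sigma>)"
  by (simp add: singular_cocycle_1_iff)

lemma singular_cocycle_1_uminus:
  "singular_cocycle 1 X \<phi> \<Longrightarrow> singular_cocycle 1 X (\<lambda>\<sigma>. - \<phi> \<sigma>)"
  by (simp add: singular_cocycle_1_iff)

text \<open>The definition gives vanishing on boundaries of single simplices, and additivity extends
  it to all chains. Hence the value of a cocycle depends only on the homology class.\<close>

lemma cocycle_eval_boundary:
  assumes "singular_cocycle p X \<phi>" "singular_relboundary p X {} b"
  shows "cochain_eval \<phi> b = 0"
proof -
  obtain d where d: "singular_chain (Suc p) X d" "chain_boundary (Suc p) d = b"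
    using assms(2) by (auto simp: singular_boundary)
  have "cochain_eval \<phi> (chain_boundary (Suc p) d) = 0"
    using d(1)[unfolded singular_chain_def]
    by (induction d rule: frag_induction)
      (use assms(1) in \<open>auto simp: singular_cocycle_def chain_boundary_diff cochain_eval_diff\<close>)
  then show ?thesis using d by simp
qed

text \<open>The pointwise product of two 1-cocycles has coboundary minus their symmetrised cup product.\<close>

lemma cup11_anticommute:
  assumes "singular_cocycle 1 X \<phi>" "singular_cocycle 1 X \<psi>" "singular_relcycle 2 X {} c"
  shows "cochain_eval (cup11 \<psi> \<phi>) c = - cochain_eval (cup11 \<phi> \<psi>) c"
proof -
  have "singular_chain 2 X c" and bd: "chain_boundary 2 c = 0"
    using assms(3) by (auto simp: singular_cycle)
  then have "Poly_Mapping.keys c \<subseteq> singular_simplex_set 2 X"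
    by (simp add: singular_chain_def)
  \<comment> \<open>Proved for all chains, one simplex at a time. If \<phi> has front and back
    values \<open>a\<close>, \<open>b\<close> and \<psi> has \<open>a'\<close>, \<open>b'\<close>,
    the claim is \<open>b b' - (a + b)(a' + b') + a a' = - a b' - a' b\<close>. For a cycle the left
    side is 0.\<close>
  then have "cochain_eval (\<lambda>\<sigma>. \<phi> \<sigma> * \<psi> \<sigma>) (chain_boundary 2 c) =
        - cochain_eval (cup11 \<phi> \<psi>) c - cochain_eval (cup11 \<psi> \<phi>) c"
  proof (induction c rule: frag_induction)
    case (one \<sigma>)
    then show ?case
      using assms(1,2)
      by (simp add: chain_boundary_2 cochain_eval_add cochain_eval_diff cup11_def
          singular_cocycle_1_iff algebra_simps)
  qed (auto simp: chain_boundary_diff cochain_eval_diff)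
  then show ?thesis using bd by simp
qed

text \<open>Up to sign, capping with a cocycle commutes with the boundary, so a bounding 3-chain of
  \<open>b\<close> yields a bounding 2-chain of the cap product.\<close>

lemma cap21_boundary:
  assumes "singular_cocycle 1 X \<phi>" "singular_relboundary 2 X {} b"
  shows "singular_relboundary 1 X {} (cap21 b \<phi>)"
proof -
  obtain d where d: "singular_chain 3 X d" "chain_boundary 3 d = b"
    using assms(2) by (auto simp: singular_boundary eval_nat_numeral)
  \<comment> \<open>Minus the cap product in degree 3: the coefficient reads \<phi> on the front
    edge \<open>[v0,v1]\<close>, and \<open>singular_face 3 0\<close> is the back face
    \<open>[v1,v2,v3]\<close>.\<close>
  define E where "E = frag_extend
    (\<lambda>\<tau>. frag_cmul (- \<phi> (singular_face 2 2 (singular_face 3 3 \<tau>))) (frag_of (singular_face 3 0 \<tau>)))"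
  have "singular_chain 2 X (E d) \<and> cap21 (chain_boundary 3 d) \<phi> = chain_boundary 2 (E d)"
    using d(1)[unfolded singular_chain_def]
  proof (induction d rule: frag_induction)
    case zero
    then show ?case by (simp add: E_def cap21_def)
  next
    case (one \<tau>)
    then have \<tau>: "singular_simplex 3 X \<tau>" by simp
    have face: "singular_simplex 2 X (singular_face 3 k \<tau>)" if "k \<le> 3" for k
      using singular_simplex_singular_face[OF \<tau>, of k] that by simp
    have ff: "singular_face 2 i (singular_face 3 j \<tau>) = singular_face 2 (j - 1) (singular_face 3 i \<tau>)"
      if "i < j" "j \<le> 3" for i j
      using singular_face_singular_face[of 2 i j \<tau>] that by (simp add: eval_nat_numeral)
    \<comment> \<open>The front edge of face 1 is \<open>[v0,v2]\<close>; the cocycle condition on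
      the face \<open>[v0,v1,v2]\<close> splits its value.\<close>
    have "\<phi> (singular_face 2 2 (singular_face 3 1 \<tau>)) =
        \<phi> (singular_face 2 2 (singular_face 3 3 \<tau>)) + \<phi> (singular_face 2 2 (singular_face 3 0 \<tau>))"
      using assms(1) face[of 3] ff[of 1 3] ff[of 0 3] by (auto simp: singular_cocycle_1_iff)
    moreover have "singular_face 2 2 (singular_face 3 2 \<tau>) = singular_face 2 2 (singular_face 3 3 \<tau>)"
      using ff[of 2 3] by simp
    ultimately have "cap21 (chain_boundary 3 (frag_of \<tau>)) \<phi> = chain_boundary 2 (E (frag_of \<tau>))"
      using ff[of 0 1] ff[of 0 2] ff[of 0 3]
      by (simp add: chain_boundary_3 cap21_add cap21_diff cap21_frag_of E_def chain_boundary_2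
          chain_boundary_cmul frag_cmul_distrib frag_cmul_distrib2 frag_cmul_diff
          chain_boundary_minus algebra_simps flip: minus_frag_cmul)
    then show ?case
      using face[of 0] by (simp add: E_def singular_chain_of singular_chain_cmul singular_chain_minus)
  next
    case (diff a b)
    then show ?case
      by (simp add: E_def frag_extend_diff singular_chain_diff chain_boundary_diff cap21_diff)
  qed
  then show ?thesis
    using d by (auto simp: singular_boundary numeral_2_eq_2)
qed

lemma cap21_homologous:
  assumes "singular_cocycle 1 X \<phi>" "homologous_rel 2 X {} c c'"
  shows "homologous_rel 1 X {} (cap21 c \<phi>) (cap21 c' \<phi>)"
  using cap21_boundary[OF assms(1), of "c - c'"] assms(2)
  by (simp add: homologous_rel_def cap21_diff)

lemma cocycle_eval_homologous:
  assumes "singular_cocycle p X \<phi>" "homologous_rel p X {} c c'"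
  shows "cochain_eval \<phi> c = cochain_eval \<phi> c'"
  using cocycle_eval_boundary[OF assms(1), of "c - c'"] assms(2)
  by (simp add: homologous_rel_def cochain_eval_diff)


section \<open>Homology classes as sets of cycles, and their dual cocycles\<close>

lemma mult_homologous_rel_set:
  "homologous_rel_set p X S a \<otimes>\<^bsub>relative_homology_group (int p) X S\<^esub> homologous_rel_set p X S b =
     homologous_rel_set p X S (a + b)"
proof -
  have "\<exists>r s. homologous_rel p X S a r \<and> homologous_rel p X S b s \<and> t = r + s"
    if "homologous_rel p X S (a + b) t" for t
  proof (intro exI conjI)
    show "homologous_rel p X S b (t - a)"
      using homologous_rel_diff[OF that homologous_rel_refl[of p X S a]] by simp
  qed auto
  then show ?thesis
    by (auto simp: mult_relative_homology_group intro: homologous_rel_add)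
qed

lemma homologous_rel_set_in_carrier_iff:
  "homologous_rel_set p X S a \<in> carrier (relative_homology_group (int p) X S) \<longleftrightarrow> singular_relcycle p X S a"
  unfolding carrier_relative_homology_group
  by (auto simp: homologous_rel_set_eq homologous_rel_singular_relcycle)

lemma inv_homologous_rel_set:
  assumes "singular_relcycle p X S a"
  shows "inv\<^bsub>relative_homology_group (int p) X S\<^esub> homologous_rel_set p X S a = homologous_rel_set p X S (- a)"
proof (rule group.inv_equality)
  show "homologous_rel_set p X S (- a) \<otimes>\<^bsub>relative_homology_group (int p) X S\<^esub> homologous_rel_set p X S a =
        \<one>\<^bsub>relative_homology_group (int p) X S\<^esub>"
    by (simp add: mult_homologous_rel_set homologous_rel_set_eq_relboundary)
qed (use assms in \<open>simp_all add: homologous_rel_set_in_carrier_iff singular_relcycle_minus\<close>)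

lemma homology_class_members:
  assumes "\<mu> \<in> carrier (relative_homology_group (int p) X S)" "c \<in> \<mu>"
  shows "singular_relcycle p X S c" "c' \<in> \<mu> \<Longrightarrow> homologous_rel p X S c c'"
proof -
  obtain d where "singular_relcycle p X S d" "\<mu> = homologous_rel_set p X S d"
    using assms(1) by (auto simp: carrier_relative_homology_group)
  with assms(2) show "singular_relcycle p X S c" "c' \<in> \<mu> \<Longrightarrow> homologous_rel p X S c c'"
    by (auto intro: homologous_rel_singular_relcycle_1 homologous_rel_trans simp: homologous_rel_sym)
qed

text \<open>For a fundamental cycle \<open>c\<close>, the cocycle \<phi> represents the Poincare
  dual of \<open>x\<close>. Naming \<open>c\<close> separates the choice of cycle from the choice of
  cocycles in \<open>has_intersection_number\<close>.\<close>

definition cap_dual :: "'a topology \<Rightarrow> 'a chain \<Rightarrow> (((nat \<Rightarrow> real) \<Rightarrow> 'a) \<Rightarrow> int) \<Rightarrow> 'a chain set \<Rightarrow> bool" where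
  "cap_dual X c \<phi> x \<longleftrightarrow> singular_cocycle 1 X \<phi> \<and> x = homologous_rel_set 1 X {} (cap21 c \<phi>)"

lemma cap_dual_change_cycle:
  assumes "cap_dual X c \<phi> x" "homologous_rel 2 X {} c c'"
  shows "cap_dual X c' \<phi> x"
  using assms cap21_homologous[of X \<phi> c c'] by (simp add: cap_dual_def homologous_rel_set_eq)

text \<open>By adjunction both sides are values of \<psi> on chains representing \<open>x\<close>,
  which a cocycle cannot distinguish.\<close>

lemma cap_dual_eval:
  assumes "cap_dual X c \<phi> x" "cap_dual X c \<phi>' x" "singular_cocycle 1 X \<psi>"
  shows "cochain_eval (cup11 \<phi> \<psi>) c = cochain_eval (cup11 \<phi>' \<psi>) c"
  using assms cocycle_eval_homologous[of 1 X \<psi> "cap21 c \<phi>" "cap21 c \<phi>'"]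
  by (simp add: cap_dual_def homologous_rel_set_eq cochain_eval_cap21)

text \<open>Independence in the first slot is \<open>cap_dual_eval\<close>; the second slot is
  brought to the first by anticommutation, for which \<open>c\<close> has to be a cycle.\<close>

lemma cap_dual_cup_unique:
  assumes c: "singular_relcycle 2 X {} c"
    and x: "cap_dual X c \<phi> x" "cap_dual X c \<phi>' x" and y: "cap_dual X c \<psi> y" "cap_dual X c \<psi>' y"
  shows "cochain_eval (cup11 \<phi> \<psi>) c = cochain_eval (cup11 \<phi>' \<psi>') c"
proof -
  have "singular_cocycle 1 X \<phi>'" "singular_cocycle 1 X \<psi>" "singular_cocycle 1 X \<psi>'"
    using x y by (simp_all add: cap_dual_def)
  then show ?thesis
    using cap_dual_eval[OF x, of \<psi>] cap_dual_eval[OF y, of \<phi>']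
      cup11_anticommute[OF _ _ c, of \<phi>' \<psi>] cup11_anticommute[OF _ _ c, of \<phi>' \<psi>'] by simp
qed

lemma has_intersection_number_iff:
  "has_intersection_number X \<mu> x y m \<longleftrightarrow>
     (\<exists>c \<phi> \<psi>. c \<in> \<mu> \<and> cap_dual X c \<phi> x \<and> cap_dual X c \<psi> y \<and> m = cochain_eval (cup11 \<phi> \<psi>) c)"
  by (auto simp: has_intersection_number_def cap_dual_def)

text \<open>Two representatives of \<mu> are homologous, so dual cocycles with respect to one are
  dual with respect to the other, and a single cycle can be used for both numbers.\<close>

lemma has_intersection_number_unique:
  assumes \<mu>: "\<mu> \<in> carrier (homology_group 2 X)"
    and "has_intersection_number X \<mu> x y m" "has_intersection_number X \<mu> x y m'"
  shows "m = m'"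
proof -
  obtain c \<phi> \<psi> where c: "c \<in> \<mu>" "cap_dual X c \<phi> x" "cap_dual X c \<psi> y" "m = cochain_eval (cup11 \<phi> \<psi>) c"
    using assms(2) by (auto simp: has_intersection_number_iff)
  obtain c' \<phi>' \<psi>' where c': "c' \<in> \<mu>" "cap_dual X c' \<phi>' x" "cap_dual X c' \<psi>' y"
      "m' = cochain_eval (cup11 \<phi>' \<psi>') c'"
    using assms(3) by (auto simp: has_intersection_number_iff)
  have \<mu>2: "\<mu> \<in> carrier (relative_homology_group (int 2) X {})"
    using \<mu> by simp
  have hom: "homologous_rel 2 X {} c c'" and c'_cycle: "singular_relcycle 2 X {} c'"
    using homology_class_members[OF \<mu>2] c(1) c'(1) by auto
  have coc: "singular_cocycle 1 X \<phi>" "singular_cocycle 1 X \<psi>"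
    using c by (simp_all add: cap_dual_def)
  have "cochain_eval (cup11 \<phi> \<psi>) c = cochain_eval (cup11 \<phi> \<psi>) c'"
    using cocycle_eval_homologous[OF coc(2) cap21_homologous[OF coc(1) hom]]
    by (simp add: cochain_eval_cap21)
  also have "\<dots> = cochain_eval (cup11 \<phi>' \<psi>') c'"
    using cap_dual_cup_unique[OF c'_cycle] cap_dual_change_cycle[OF _ hom] c c' by blast
  finally show ?thesis
    using c(4) c'(4) by simp
qed

lemma intersection_form_eqI:
  assumes "\<mu> \<in> carrier (homology_group 2 X)" "has_intersection_number X \<mu> x y m"
  shows "intersection_form X \<mu> x y = m"
  unfolding intersection_form_def
  using assms has_intersection_number_unique by (intro the_equality) auto

text \<open>The generation principle: a subgroup that contains a basis contains everything. It
  serves for the classes having a dual, for the equality of representations, and for the kernel of a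
  character.\<close>

lemma (in comm_group) finprod_int_pow_in_subgroup:
  assumes "subgroup D G" "\<And>i. i \<in> I \<Longrightarrow> f i \<in> D"
  shows "finprod G (\<lambda>i. f i [^] (k i :: int)) I \<in> D"
proof -
  show ?thesis
    using assms(2)
  proof (induction I rule: infinite_finite_induct)
    case (insert i I)
    have pow: "f j [^] k j \<in> D" if "j \<in> insert i I" for j
      using insert.prems[OF that] by (rule subgroup_int_pow_closed[OF assms(1)])
    then have "finprod G (\<lambda>i. f i [^] k i) (insert i I) = f i [^] k i \<otimes> finprod G (\<lambda>i. f i [^] k i) I"
      using insert.hyps subgroup.subset[OF assms(1)] by (intro finprod_insert) auto
    then show ?case
      using insert pow by (simp add: subgroup.m_closed[OF assms(1)])
  \<comment> \<open>Empty and infinite index sets remain; over an infinite set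
    \<open>finprod\<close> is the unit by convention.\<close>
  qed (auto simp: assms(1) subgroup.one_closed)
qed

lemma cap_dual_mult:
  assumes "cap_dual X c \<phi> x" "cap_dual X c \<psi> y"
  shows "cap_dual X c (\<lambda>\<sigma>. \<phi> \<sigma> + \<psi> \<sigma>) (x \<otimes>\<^bsub>homology_group 1 X\<^esub> y)"
  using assms singular_cocycle_1_add[of X \<phi> \<psi>]
    mult_homologous_rel_set[of 1 X "{}" "cap21 c \<phi>" "cap21 c \<psi>"]
  by (simp add: cap_dual_def cap21_plus)

text \<open>Together with the duals of the basis elements, which the intersection numbers of a
  symplectic basis provide, this yields a dual for every class: the surjective half of Poincare
  duality in the form needed here.\<close>

lemma subgroup_cap_duals:
  "subgroup {x \<in> carrier (homology_group 1 X). \<exists>\<phi>. cap_dual X c \<phi> x} (homology_group 1 X)"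
  (is "subgroup ?D ?H")
proof -
  interpret comm_group ?H
    by (rule abelian_homology_group)
  show ?thesis
  proof (rule subgroupI)
    show "?D \<subseteq> carrier ?H"
      by auto
    have "cap_dual X c (\<lambda>_. 0) \<one>\<^bsub>?H\<^esub>"
      using one_relative_homology_group[of 1 X "{}"]
        homologous_rel_set_eq_relboundary[of 1 X "{}" 0]
      by (simp add: cap_dual_def singular_cocycle_1_iff cap21_def frag_extend_def)
    then show "?D \<noteq> {}"
      by blast
  next
    fix x assume "x \<in> ?D"
    then obtain \<phi> where x: "x \<in> carrier ?H" "cap_dual X c \<phi> x" by auto
    have "inv\<^bsub>?H\<^esub> x = homologous_rel_set 1 X {} (cap21 c (\<lambda>\<sigma>. - \<phi> \<sigma>))"
      using x inv_homologous_rel_set[of 1 X "{}" "cap21 c \<phi>"]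
        homologous_rel_set_in_carrier_iff[of 1 X "{}" "cap21 c \<phi>"]
      by (simp add: cap_dual_def cap21_uminus)
    then have "cap_dual X c (\<lambda>\<sigma>. - \<phi> \<sigma>) (inv\<^bsub>?H\<^esub> x)"
      using x singular_cocycle_1_uminus[of X \<phi>] by (simp add: cap_dual_def)
    then show "inv\<^bsub>?H\<^esub> x \<in> ?D"
      using x by auto
  next
    fix x y assume "x \<in> ?D" "y \<in> ?D"
    then obtain \<phi> \<psi> where xy: "x \<in> carrier ?H" "cap_dual X c \<phi> x" "y \<in> carrier ?H" "cap_dual X c \<psi> y"
      by auto
    have "cap_dual X c (\<lambda>\<sigma>. \<phi> \<sigma> + \<psi> \<sigma>) (x \<otimes>\<^bsub>?H\<^esub> y)"
      using xy by (intro cap_dual_mult)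
    then show "x \<otimes>\<^bsub>?H\<^esub> y \<in> ?D"
      using xy by auto
  qed
qed

text \<open>What the density argument retains of the surface. The group is written multiplicatively,
  so \<open>x [^] k\<close> is the integer multiple \<open>k x\<close>.\<close>

locale symplectic_lattice = comm_group G for G (structure) +
  fixes form :: "'a \<Rightarrow> 'a \<Rightarrow> int" and g :: nat and e :: "nat \<Rightarrow> 'a"
  assumes form_mult_left:
      "\<lbrakk>x \<in> carrier G; y \<in> carrier G; z \<in> carrier G\<rbrakk> \<Longrightarrow> form (x \<otimes> y) z = form x z + form y z"
    and form_antisym: "\<lbrakk>x \<in> carrier G; y \<in> carrier G\<rbrakk> \<Longrightarrow> form x y = - form y x"
    and genus_pos: "g > 0"
    and basis_closed: "i < 2 * g \<Longrightarrow> e i \<in> carrier G"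
    and basis_ex1: "x \<in> carrier G \<Longrightarrow> \<exists>!k :: nat \<Rightarrow> int. k \<in> extensional {..<2 * g} \<and>
        x = finprod G (\<lambda>i. e i [^] k i) {..<2 * g}"
    and form_basis: "\<lbrakk>i < 2 * g; j < 2 * g\<rbrakk> \<Longrightarrow> form (e i) (e j) = symplectic_matrix g i j"

text \<open>All duals are taken with respect to one fundamental cycle; sums of cocycles then give
  biadditivity, and anticommutation of the cup product gives antisymmetry.\<close>

theorem symplectic_lattice_homology:
  assumes \<mu>: "\<mu> \<in> carrier (homology_group 2 X)" and "g > 0" and "symplectic_basis X \<mu> g e"
  shows "symplectic_lattice (homology_group 1 X) (intersection_form X \<mu>) g e"
proof -
  let ?H = "homology_group 1 X"
  interpret comm_group ?H
    by (rule abelian_homology_group)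
  have basis: "homology_basis X (2 * g) e"
    and num: "\<And>i j. \<lbrakk>i < 2 * g; j < 2 * g\<rbrakk> \<Longrightarrow>
        has_intersection_number X \<mu> (e i) (e j) (symplectic_matrix g i j)"
    using assms(3) by (auto simp: symplectic_basis_def)
  have ex1: "\<forall>x\<in>carrier ?H. \<exists>!k :: nat \<Rightarrow> int. k \<in> extensional {..<2 * g} \<and>
        x = finprod ?H (\<lambda>i. e i [^]\<^bsub>?H\<^esub> k i) {..<2 * g}"
    using basis unfolding homology_basis_def by (rule conjunct2)
  have e: "e i \<in> carrier ?H" if "i < 2 * g" for i
    using basis that by (simp add: homology_basis_def)
  \<comment> \<open>Since \<open>g > 0\<close> there is a basis element with index 0, whose
    intersection number with itself supplies a representative of \<mu>.\<close>
  obtain c where c: "c \<in> \<mu>"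
    using num[of 0 0] \<open>g > 0\<close> by (auto simp: has_intersection_number_iff)
  have cycle: "singular_relcycle 2 X {} c" and hom: "\<And>c'. c' \<in> \<mu> \<Longrightarrow> homologous_rel 2 X {} c' c"
    using homology_class_members[of \<mu> 2 X "{}" c] homology_class_members(2)[of \<mu> 2 X "{}" _ c] \<mu> c
    by simp_all
  let ?D = "{x \<in> carrier ?H. \<exists>\<phi>. cap_dual X c \<phi> x}"
  have eD: "e i \<in> ?D" if i: "i < 2 * g" for i
  proof -
    \<comment> \<open>The cycle here varies with \<open>i\<close>; the dual is then carried over to
      the fixed cycle \<open>c\<close>.\<close>
    obtain c' \<phi> where "c' \<in> \<mu>" "cap_dual X c' \<phi> (e i)"
      using num[OF i i] unfolding has_intersection_number_iff by blast
    then show ?thesis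
      using cap_dual_change_cycle[OF _ hom] e[OF i] by blast
  qed
  have D: "finprod ?H (\<lambda>i. e i [^]\<^bsub>?H\<^esub> k i) {..<2 * g} \<in> ?D" for k :: "nat \<Rightarrow> int"
    by (rule finprod_int_pow_in_subgroup[OF subgroup_cap_duals eD]) simp
  have has_dual: "\<exists>\<phi>. cap_dual X c \<phi> x" if x: "x \<in> carrier ?H" for x
  proof -
    obtain k :: "nat \<Rightarrow> int" where "x = finprod ?H (\<lambda>i. e i [^]\<^bsub>?H\<^esub> k i) {..<2 * g}"
      using ex1_implies_ex[OF bspec[OF ex1 x]] by blast
    then show ?thesis
      using D[of k] by simp
  qed
  have form: "intersection_form X \<mu> x y = cochain_eval (cup11 \<phi> \<psi>) c"
    if "cap_dual X c \<phi> x" "cap_dual X c \<psi> y" for \<phi> \<psi> x y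
    using that c by (intro intersection_form_eqI[OF \<mu>]) (auto simp: has_intersection_number_iff)
  show ?thesis
  proof unfold_locales
    fix x y z assume xyz: "x \<in> carrier ?H" "y \<in> carrier ?H" "z \<in> carrier ?H"
    then obtain \<phi> \<psi> \<theta> where d: "cap_dual X c \<phi> x" "cap_dual X c \<psi> y" "cap_dual X c \<theta> z"
      using has_dual by metis
    show "intersection_form X \<mu> (x \<otimes>\<^bsub>?H\<^esub> y) z = intersection_form X \<mu> x z + intersection_form X \<mu> y z"
      using form[OF cap_dual_mult[OF d(1,2)] d(3)] form[OF d(1,3)] form[OF d(2,3)]
      by (simp add: cap21_plus cochain_eval_add flip: cochain_eval_cap21)
  next
    fix x y assume xy: "x \<in> carrier ?H" "y \<in> carrier ?H"
    then obtain \<phi> \<psi> where d: "cap_dual X c \<phi> x" "cap_dual X c \<psi> y"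
      using has_dual by metis
    show "intersection_form X \<mu> x y = - intersection_form X \<mu> y x"
      using form[OF d] form[OF d(2,1)] cup11_anticommute[OF _ _ cycle, of \<phi> \<psi>] d
      by (simp add: cap_dual_def)
  next
    show "intersection_form X \<mu> (e i) (e j) = symplectic_matrix g i j" if "i < 2 * g" "j < 2 * g" for i j
      using that num by (intro intersection_form_eqI[OF \<mu>])
  next
    show "\<exists>!k :: nat \<Rightarrow> int. k \<in> extensional {..<2 * g} \<and>
        x = finprod ?H (\<lambda>i. e i [^]\<^bsub>?H\<^esub> k i) {..<2 * g}" if "x \<in> carrier ?H" for x
      using that by (rule bspec[OF ex1])
  qed (use \<open>g > 0\<close> e in simp_all)
qed

section \<open>Unipotent symplectic maps\<close>

context symplectic_lattice
begin

definition Sp :: "('a \<Rightarrow> 'a) set" where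
  "Sp = {\<phi> \<in> iso G G. \<forall>x\<in>carrier G. \<forall>y\<in>carrier G. form (\<phi> x) (\<phi> y) = form x y}"

lemma form_mult_right:
  "\<lbrakk>x \<in> carrier G; y \<in> carrier G; z \<in> carrier G\<rbrakk> \<Longrightarrow> form x (y \<otimes> z) = form x y + form x z"
  using form_antisym[of x "y \<otimes> z"] form_antisym[of x y] form_antisym[of x z]
  by (simp add: form_mult_left)

lemma form_self: "x \<in> carrier G \<Longrightarrow> form x x = 0"
  using form_antisym[of x x] by simp

lemma form_one_left: "x \<in> carrier G \<Longrightarrow> form \<one> x = 0"
  using form_mult_left[of \<one> \<one> x] by simp

lemma form_pow_left:
  assumes "x \<in> carrier G" "y \<in> carrier G"
  shows "form (x [^] (k :: int)) y = k * form x y"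
proof -
  have step: "form (x [^] (i + 1)) y = form (x [^] i) y + form x y" for i :: int
    using assms by (simp add: int_pow_mult form_mult_left)
  show ?thesis
  proof (induction k rule: int_induct[where k = 0])
    case base
    show ?case
      using assms by (simp add: form_one_left)
  next
    case (step1 i)
    then show ?case
      by (simp only: step) (simp add: algebra_simps)
  next
    case (step2 i)
    then show ?case
      using step[of "i - 1"] by (simp add: algebra_simps)
  qed
qed

lemma form_pow_right:
  "\<lbrakk>x \<in> carrier G; y \<in> carrier G\<rbrakk> \<Longrightarrow> form x (y [^] (k :: int)) = k * form x y"
  using form_antisym[of x "y [^] k"] form_antisym[of x y] by (simp add: form_pow_left)

lemmas form_simps = form_mult_left form_mult_right form_pow_left form_pow_right

lemma Sp_closed: "\<phi> \<in> Sp \<Longrightarrow> x \<in> carrier G \<Longrightarrow> \<phi> x \<in> carrier G"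
  by (auto simp: Sp_def iso_def hom_def)

lemma Sp_bij: "\<phi> \<in> Sp \<Longrightarrow> bij_betw \<phi> (carrier G) (carrier G)"
  by (auto simp: Sp_def iso_def)

lemma Sp_inv:
  assumes "\<phi> \<in> Sp"
  shows "inv_into (carrier G) \<phi> \<in> Sp"
proof -
  have surj: "\<phi> ` carrier G = carrier G"
    using Sp_bij[OF assms] by (simp add: bij_betw_def)
  have "form (inv_into (carrier G) \<phi> x) (inv_into (carrier G) \<phi> y) = form x y"
    if "x \<in> carrier G" "y \<in> carrier G" for x y
  proof -
    have "x \<in> \<phi> ` carrier G" "y \<in> \<phi> ` carrier G"
      using that surj by simp_all
    moreover from this have "inv_into (carrier G) \<phi> x \<in> carrier G" "inv_into (carrier G) \<phi> y \<in> carrier G"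
      by (simp_all only: inv_into_into)
    then have "form (\<phi> (inv_into (carrier G) \<phi> x)) (\<phi> (inv_into (carrier G) \<phi> y)) =
        form (inv_into (carrier G) \<phi> x) (inv_into (carrier G) \<phi> y)"
      using assms by (simp add: Sp_def inv_into_into)
    ultimately show ?thesis
      by (simp add: f_inv_into_f)
  qed
  moreover have "inv_into (carrier G) \<phi> \<in> iso G G"
    using assms by (intro iso_set_sym) (simp add: Sp_def)
  ultimately show ?thesis
    by (simp add: Sp_def)
qed

lemma Sp_comp:
  assumes "\<phi> \<in> Sp" "\<psi> \<in> Sp"
  shows "\<psi> \<circ> \<phi> \<in> Sp"
  using assms Sp_closed[OF assms(1)] iso_set_trans[of \<phi> G G \<psi> G] by (auto simp: Sp_def)

lemma hom_pow: "N \<in> hom G G \<Longrightarrow> x \<in> carrier G \<Longrightarrow> N (x [^] (k :: int)) = N x [^] k"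
  by (rule hom_int_pow) (auto intro: group_axioms)

text \<open>Additively the map is \<open>1 + k N\<close>, the exponential of \<open>k N\<close>,
  with inverse \<open>1 - k N\<close>. In the form of two images, skewness cancels the terms linear
  in \<open>k\<close>, and the quadratic term vanishes because
  \<open>form (N x) (N y) = - form x (N (N y))\<close>.\<close>

lemma exp_square_zero_in_Sp:
  assumes N: "N \<in> hom G G" and sq: "\<And>x. x \<in> carrier G \<Longrightarrow> N (N x) = \<one>"
    and skew: "\<And>x y. \<lbrakk>x \<in> carrier G; y \<in> carrier G\<rbrakk> \<Longrightarrow> form (N x) y = - form x (N y)"
  shows "(\<lambda>x. x \<otimes> N x [^] (k :: int)) \<in> Sp"
proof -
  have Nc: "N x \<in> carrier G" if "x \<in> carrier G" for x
    using N that by (auto simp: hom_def)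
  have Nm: "N (x \<otimes> y) = N x \<otimes> N y" if "x \<in> carrier G" "y \<in> carrier G" for x y
    using N that by (auto simp: hom_def)
  \<comment> \<open>Stated for every exponent, so that \<open>k\<close> and \<open>- k\<close> give
    the two halves of bijectivity.\<close>
  have inverse: "(x \<otimes> N x [^] k) \<otimes> N (x \<otimes> N x [^] k) [^] (- k) = x" if "x \<in> carrier G" for x and k :: int
  proof -
    have "N (x \<otimes> N x [^] k) = N x"
      using that by (simp add: Nm Nc hom_pow[OF N] sq)
    moreover have "x \<otimes> N x [^] k \<otimes> N x [^] (- k) = x \<otimes> (N x [^] k \<otimes> N x [^] (- k))"
      using that by (intro m_assoc) (simp_all add: Nc)
    ultimately show ?thesis
      using that by (simp add: Nc int_pow_neg)
  qed
  have "bij_betw (\<lambda>x. x \<otimes> N x [^] k) (carrier G) (carrier G)"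
    by (rule bij_betw_byWitness[where f' = "\<lambda>x. x \<otimes> N x [^] (- k)"])
      (use inverse[of _ k] inverse[of _ "- k"] in \<open>auto simp: Nc\<close>)
  moreover have "(\<lambda>x. x \<otimes> N x [^] k) \<in> hom G G"
    by (rule homI) (auto simp: Nc Nm int_pow_distrib m_ac)
  moreover have "form (x \<otimes> N x [^] k) (y \<otimes> N y [^] k) = form x y"
    if "x \<in> carrier G" "y \<in> carrier G" for x y
  proof -
    have "form x \<one> = 0"
      using that form_antisym[of x \<one>] by (simp add: form_one_left)
    then have "form (N x) (N y) = 0"
      using skew[of x "N y"] that by (simp add: Nc sq)
    then show ?thesis
      using that skew[of x y] by (simp add: form_simps Nc)
  qed
  ultimately show ?thesis
    by (simp add: Sp_def iso_def)
qed

text \<open>For \<open>u = w\<close> this is twice the logarithm of a transvection; the factor 2 is harmless for density.\<close>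

definition eichler_map :: "'a \<Rightarrow> 'a \<Rightarrow> 'a \<Rightarrow> 'a" where
  "eichler_map u w x = u [^] form x w \<otimes> w [^] form x u"

lemma eichler_map_hom:
  assumes "u \<in> carrier G" "w \<in> carrier G"
  shows "eichler_map u w \<in> hom G G"
proof (rule homI)
  show "eichler_map u w x \<in> carrier G" if "x \<in> carrier G" for x
    using assms by (simp add: eichler_map_def)
  show "eichler_map u w (x \<otimes> y) = eichler_map u w x \<otimes> eichler_map u w y" if "x \<in> carrier G" "y \<in> carrier G" for x y
  proof -
    have swap: "(a \<otimes> b) \<otimes> (c \<otimes> d) = (a \<otimes> c) \<otimes> (b \<otimes> d)"
      if "a \<in> carrier G" "b \<in> carrier G" "c \<in> carrier G" "d \<in> carrier G" for a b c d
      using that by (simp add: m_ac)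
    have "eichler_map u w (x \<otimes> y) = (u [^] form x w \<otimes> u [^] form y w) \<otimes> (w [^] form x u \<otimes> w [^] form y u)"
      using assms that by (simp add: eichler_map_def form_mult_left int_pow_mult)
    also have "\<dots> = eichler_map u w x \<otimes> eichler_map u w y"
      unfolding eichler_map_def using assms by (intro swap) auto
    finally show ?thesis .
  qed
qed

text \<open>The image of the Eichler map lies in the span of \<open>u\<close> and \<open>w\<close>.
  Orthogonality makes this span isotropic, and the map kills it, so its square is zero.\<close>

lemma exp_eichler_map_in_Sp:
  assumes u: "u \<in> carrier G" and w: "w \<in> carrier G" and "form u w = 0"
  shows "(\<lambda>x. x \<otimes> eichler_map u w x [^] (k :: int)) \<in> Sp"
proof (rule exp_square_zero_in_Sp[OF eichler_map_hom[OF u w]])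
  have "form w u = 0"
    using assms form_antisym[of w u] by simp
  then show "eichler_map u w (eichler_map u w x) = \<one>" if "x \<in> carrier G" for x
    using assms that by (simp add: eichler_map_def form_simps form_self)
  show "form (eichler_map u w x) y = - form x (eichler_map u w y)" if "x \<in> carrier G" "y \<in> carrier G" for x y
    using u w that form_antisym[of u y] form_antisym[of w y] by (simp add: eichler_map_def form_simps)
qed

section \<open>Symplectic partners of basis elements, and shears\<close>

definition dual_index :: "nat \<Rightarrow> nat" where
  "dual_index i = (if i < g then i + g else i - g)"

lemma dual_index_less: "i < 2 * g \<Longrightarrow> dual_index i < 2 * g"
  by (auto simp: dual_index_def)

lemma dual_index_dual_index: "i < 2 * g \<Longrightarrow> dual_index (dual_index i) = i"
  by (auto simp: dual_index_def)

lemma dual_index_eq_iff: "\<lbrakk>i < 2 * g; j < 2 * g\<rbrakk> \<Longrightarrow> dual_index i = dual_index j \<longleftrightarrow> i = j"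
  by (metis dual_index_dual_index)

lemma dual_index_neq: "i < 2 * g \<Longrightarrow> dual_index i \<noteq> i"
  using genus_pos by (auto simp: dual_index_def)

lemma form_basis_eq_0_iff:
  "\<lbrakk>i < 2 * g; j < 2 * g\<rbrakk> \<Longrightarrow> form (e i) (e j) = 0 \<longleftrightarrow> j \<noteq> dual_index i"
  using genus_pos by (auto simp: form_basis symplectic_matrix_def dual_index_def)

text \<open>The witness is the Eichler map of \<open>e p\<close> and the partner of
  \<open>e i\<close>, which are orthogonal because \<open>i \<noteq> p\<close>. Besides
  \<open>e i\<close>, the only basis element it can move is the partner of \<open>e p\<close>. For
  density all that matters about \<open>c\<close> is that it is nonzero.\<close>

lemma exists_shear:
  assumes p: "p < 2 * g" and i: "i < 2 * g" and "i \<noteq> p"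
  shows "\<exists>N (c :: int). N \<in> hom G G \<and> c \<noteq> 0 \<and> N (e i) = e p [^] c \<and>
    (\<forall>j<2 * g. j \<noteq> i \<longrightarrow> j \<noteq> dual_index p \<longrightarrow> N (e j) = \<one>) \<and>
    (\<forall>k :: int. (\<lambda>x. x \<otimes> N x [^] k) \<in> Sp)"
proof -
  let ?w = "e (dual_index i)"
  \<comment> \<open>If \<open>i\<close> is the partner index of \<open>p\<close>, then
    \<open>?w\<close> is \<open>e p\<close> itself, and the two factors of the Eichler map coincide
    and double the exponent.\<close>
  let ?c = "if i = dual_index p then 2 * form (e i) (e p) else form (e i) ?w"
  have ep: "e p \<in> carrier G" and ew: "?w \<in> carrier G" and ei: "e i \<in> carrier G"
    using p i by (auto intro: basis_closed dual_index_less)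
  have 1: "eichler_map (e p) ?w \<in> hom G G"
    by (rule eichler_map_hom[OF ep ew])
  have 2: "?c \<noteq> 0"
    using p i form_basis_eq_0_iff[of i p] form_basis_eq_0_iff[of i "dual_index i"] dual_index_dual_index[of p]
    by (auto simp: dual_index_less)
  have 3: "eichler_map (e p) ?w (e i) = e p [^] ?c"
  proof (cases "i = dual_index p")
    case True
    then show ?thesis
      using p ep int_pow_mult[OF ep, of "form (e i) (e p)" "form (e i) (e p)"]
      by (simp add: eichler_map_def dual_index_dual_index)
  next
    case False
    then have "form (e i) (e p) = 0"
      using p i form_basis_eq_0_iff[of i p] dual_index_dual_index by auto
    then show ?thesis
      using ep ew False by (simp add: eichler_map_def)
  qed
  have 4: "eichler_map (e p) ?w (e j) = \<one>" if j: "j < 2 * g" "j \<noteq> i" "j \<noteq> dual_index p" for j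
  proof -
    have "form (e j) ?w = 0" "form (e j) (e p) = 0"
      using j p i form_basis_eq_0_iff[of j "dual_index i"] form_basis_eq_0_iff[of j p] dual_index_eq_iff[of i j]
        dual_index_dual_index[of j] dual_index_less[of i] by auto
    then show ?thesis
      using ep ew by (simp add: eichler_map_def)
  qed
  have "form (e p) ?w = 0"
    using p i \<open>i \<noteq> p\<close> form_basis_eq_0_iff[of p "dual_index i"] dual_index_eq_iff[of p i] dual_index_less[of i]
    by auto
  then have 5: "(\<lambda>x. x \<otimes> eichler_map (e p) ?w x [^] k) \<in> Sp" for k :: int
    by (rule exp_eichler_map_in_Sp[OF ep ew])
  show ?thesis
    by (intro exI[of _ "eichler_map (e p) ?w"] exI[of _ ?c] conjI allI impI 1 2 3 5) (rule 4)
qed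

end

section \<open>Recurrence and density in tori\<close>

lemma dist_cis_le: "dist (cis a) (cis b) \<le> \<bar>a - b\<bar>"
proof -
  have "cis a - cis b = cis b * (exp (\<i> * of_real (a - b)) - 1)"
    by (simp only: right_diff_distrib cis_mult flip: cis_conv_exp) simp
  \<comment> \<open>The length of the chord; it is at most the length of the arc.\<close>
  then have "dist (cis a) (cis b) = 2 * \<bar>sin ((a - b) / 2)\<bar>"
    by (simp only: dist_norm norm_mult norm_cis dist_exp_i_1)
  also have "\<dots> \<le> 2 * \<bar>(a - b) / 2\<bar>"
    using abs_sin_x_le_abs_x[of "(a - b) / 2"] by linarith
  finally show ?thesis by simp
qed

lemma unit_complex_cis:
  assumes "norm z = 1"
  obtains t where "z = cis (2 * pi * t)"
  using cis_Arg[of z] assms that[of "Arg z / (2 * pi)"] by (force simp: sgn_div_norm)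

text \<open>Angles are counted in full turns, so the integer \<open>m\<close> is invisible and an
  error in turns costs at most a factor \<open>2 * pi\<close>.\<close>

lemma dist_cis_approx:
  assumes "\<bar>of_int k * s - of_int m - t\<bar> < \<epsilon> / (2 * pi)"
  shows "dist (cis (2 * pi * s) powi k) (cis (2 * pi * t)) < \<epsilon>"
proof -
  have "cis (2 * pi * t) = cis (2 * pi * t) * cis (2 * pi * of_int m)"
    by simp
  then have "dist (cis (2 * pi * s) powi k) (cis (2 * pi * t)) =
      dist (cis (2 * pi * (of_int k * s))) (cis (2 * pi * (of_int m + t)))"
    by (simp add: cis_power_int cis_mult algebra_simps)
  also have "\<dots> \<le> \<bar>2 * pi * (of_int k * s) - 2 * pi * (of_int m + t)\<bar>"
    by (rule dist_cis_le)
  also have "\<dots> = 2 * pi * \<bar>of_int k * s - of_int m - t\<bar>"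
    by (simp add: abs_mult flip: right_diff_distrib)
  also have "\<dots> < \<epsilon>"
    using assms by (simp add: field_simps)
  finally show ?thesis .
qed

text \<open>Dirichlet's simultaneous approximation, applied to the angles in turns. Its content lies
  in \<open>k > 0\<close>, which rules out the trivial exponent.\<close>

lemma unit_complex_recurrence:
  assumes "finite I" "\<And>i. i \<in> I \<Longrightarrow> norm (z i :: complex) = 1" "\<epsilon> > 0"
  obtains k :: int where "k > 0" "\<And>i. i \<in> I \<Longrightarrow> dist (z i powi k) 1 < \<epsilon>"
proof -
  have "\<forall>i\<in>I. \<exists>t. z i = cis (2 * pi * t)"
    using unit_complex_cis[OF assms(2)] by blast
  from bchoice[OF this] obtain t where t: "\<And>i. i \<in> I \<Longrightarrow> z i = cis (2 * pi * t i)"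
    by blast
  obtain b where b: "bij_betw b {..<card I} I"
    using ex_bij_betw_nat_finite[OF assms(1)] by (auto simp: atLeast0LessThan)
  obtain n where n: "inverse (real (Suc n)) < \<epsilon> / (2 * pi)"
    using reals_Archimedean[of "\<epsilon> / (2 * pi)"] assms(3) by auto
  obtain k p where k: "0 < k"
      "\<And>i. i < card I \<Longrightarrow> \<bar>of_int k * (t \<circ> b) i - of_int (p i)\<bar> < 1 / real (Suc n)"
    using Dirichlet_approx_simult[of "Suc n" "card I" "t \<circ> b"] by (metis zero_less_Suc)
  have "dist (z i powi k) 1 < \<epsilon>" if i: "i \<in> I" for i
  proof -
    obtain j where j: "j < card I" "i = b j"
      using b i by (auto simp: bij_betw_def)
    show ?thesis
      using dist_cis_approx[of k "t i" "p j" 0 \<epsilon>] k(2)[OF j(1)] n j(2) t[OF i]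
      by (simp add: inverse_eq_divide)
  qed
  with k(1) show thesis by (rule that)
qed

text \<open>Taking angles turns the absence of multiplicative relations into integer-linear
  independence of the angles together with 1, the hypothesis of Kronecker's additive
  theorem.\<close>

lemma unit_complex_Kronecker:
  assumes "finite I" and z: "\<And>i. i \<in> I \<Longrightarrow> norm (z i :: complex) = 1"
    and w: "\<And>i. i \<in> I \<Longrightarrow> norm (w i :: complex) = 1" and "\<epsilon> > 0"
    and indep: "\<And>m :: 'i \<Rightarrow> int. (\<Prod>i\<in>I. z i powi m i) = 1 \<Longrightarrow> \<forall>i\<in>I. m i = 0"
  obtains k :: int where "\<And>i. i \<in> I \<Longrightarrow> dist (z i powi k) (w i) < \<epsilon>"
proof -
  have "\<forall>i\<in>I. \<exists>t. z i = cis (2 * pi * t)"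
    using unit_complex_cis[OF z] by blast
  moreover have "\<forall>i\<in>I. \<exists>t. w i = cis (2 * pi * t)"
    using unit_complex_cis[OF w] by blast
  ultimately obtain t s where t: "\<And>i. i \<in> I \<Longrightarrow> z i = cis (2 * pi * t i)"
      and s: "\<And>i. i \<in> I \<Longrightarrow> w i = cis (2 * pi * s i)"
    using bchoice[of I] by (metis (no_types))
  obtain b where b: "bij_betw b {..<card I} I"
    using ex_bij_betw_nat_finite[OF assms(1)] by (auto simp: atLeast0LessThan)
  define n where "n = card I"
  \<comment> \<open>The angles in turns occupy the indices below \<open>n\<close>; the constant 1,
    standing for full turns, sits at index \<open>n\<close>.\<close>
  define \<theta> where "\<theta> = (\<lambda>j. if j < n then t (b j) else 1)"
  have bI: "j < n \<Longrightarrow> b j \<in> I" for j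
    using b by (auto simp: bij_betw_def n_def)
  have zero: "\<forall>j\<le>n. c j = 0" if c: "(\<Sum>j\<le>n. of_int (c j) * \<theta> j) = 0" for c :: "nat \<Rightarrow> int"
  proof -
    define m where "m i = c (inv_into {..<n} b i)" for i
    have mb: "m (b j) = c j" if "j < n" for j
      using b that by (simp add: m_def n_def bij_betw_def)
    have cn: "(\<Sum>j<n. of_int (c j) * t (b j)) = - of_int (c n)"
      using c by (simp add: \<theta>_def flip: lessThan_Suc_atMost)
    have "(\<Prod>i\<in>I. z i powi m i) = (\<Prod>j<n. z (b j) powi m (b j))"
      using prod.reindex_bij_betw[OF b[folded n_def], of "\<lambda>i. z i powi m i"] by simp
    also have "\<dots> = (\<Prod>j<n. cis (2 * pi * (of_int (c j) * t (b j))))"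
      by (rule prod.cong) (simp_all add: t bI mb cis_power_int algebra_simps)
    also have "\<dots> = cis (2 * pi * (\<Sum>j<n. of_int (c j) * t (b j)))"
      by (induction n) (simp_all add: cis_mult algebra_simps)
    also have "\<dots> = 1"
      unfolding cn using cis_multiple_2pi[of "- of_int (c n)"] by simp
    finally have "\<forall>i\<in>I. m i = 0"
      by (rule indep)
    then have "c j = 0" if "j < n" for j
      using mb[OF that] bI[OF that] by simp
    moreover from this cn have "c n = 0"
      by simp
    ultimately show ?thesis
      by (metis le_neq_implies_less)
  qed
  \<comment> \<open>Independence is a property of the set of values, so a repeated angle must be
    excluded separately.\<close>
  have inj: "inj_on \<theta> {..n}"
  proof (rule inj_onI, rule ccontr)
    fix i j assume ij: "i \<in> {..n}" "j \<in> {..n}" "\<theta> i = \<theta> j" "i \<noteq> j"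
    define c where "c = (\<lambda>l. if l = i then 1 else if l = j then - 1 else 0 :: int)"
    have "(\<Sum>l\<le>n. of_int (c l) * \<theta> l) = (\<Sum>l\<in>{i, j}. of_int (c l) * \<theta> l)"
      by (rule sum.mono_neutral_right) (use ij in \<open>auto simp: c_def\<close>)
    also have "\<dots> = 0"
      using ij by (simp add: c_def)
    finally have "c i = 0"
      using zero ij by blast
    then show False
      by (simp add: c_def)
  qed
  \<comment> \<open>Independence is meant over the integers, so the reals are viewed as an integer
    module.\<close>
  interpret Modules.module "\<lambda>r x. real_of_int r * x"
    by (simp add: Modules.module.intro distrib_left mult.commute)
  have "independent (\<theta> ` {..n})"
    unfolding independent_explicit_module
  proof (intro allI impI)
    fix A u v assume A: "finite A" "A \<subseteq> \<theta> ` {..n}" "(\<Sum>v\<in>A. real_of_int (u v) * v) = 0" "v \<in> A"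
    define c where "c j = (if \<theta> j \<in> A then u (\<theta> j) else 0)" for j
    have "(\<Sum>j\<le>n. of_int (c j) * \<theta> j) = (\<Sum>x\<in>\<theta> ` {..n}. of_int (if x \<in> A then u x else 0) * x)"
      by (simp add: sum.reindex[OF inj] c_def)
    also have "\<dots> = (\<Sum>x\<in>A. of_int (if x \<in> A then u x else 0) * x)"
      by (rule sum.mono_neutral_right) (use A in auto)
    also have "\<dots> = 0"
      using A(3) by simp
    finally have "\<forall>j\<le>n. c j = 0"
      by (rule zero)
    moreover obtain j where "j \<le> n" "v = \<theta> j"
      using A(2,4) by auto
    ultimately show "u v = 0"
      using A(4) by (metis c_def)
  qed
  then obtain k m where k: "\<And>j. j < n \<Longrightarrow> \<bar>of_int k * \<theta> j - of_int (m j) - s (b j)\<bar> < \<epsilon> / (2 * pi)"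
    using Kronecker_thm_2[of \<theta> n "\<epsilon> / (2 * pi)" "s \<circ> b"] inj assms(4) by (auto simp: \<theta>_def)
  have "dist (z i powi k) (w i) < \<epsilon>" if i: "i \<in> I" for i
  proof -
    obtain j where j: "j < n" "i = b j"
      using b i by (auto simp: bij_betw_def n_def)
    show ?thesis
      using dist_cis_approx[of k "t i" "m j" "s i" \<epsilon>] k[OF j(1)] j t[OF i] s[OF i] by (simp add: \<theta>_def)
  qed
  then show thesis by (rule that)
qed

section \<open>The torus group, its characters and its topological generators\<close>

lemma torus_carrier_iff: "z \<in> carrier torus_group \<longleftrightarrow> (\<forall>i. norm (z $ i) = 1)"
  by (simp add: torus_group_def)

lemma torus_mult_nth [simp]: "(z \<otimes>\<^bsub>torus_group\<^esub> w) $ i = z $ i * w $ i"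
  by (simp add: torus_group_def)

lemma torus_one_nth [simp]: "\<one>\<^bsub>torus_group\<^esub> $ i = 1"
  by (simp add: torus_group_def)

lemma torus_nth_nonzero: "z \<in> carrier torus_group \<Longrightarrow> z $ i \<noteq> 0"
  by (metis norm_zero torus_carrier_iff zero_neq_one)

lemma comm_group_torus: "comm_group torus_group"
proof (rule comm_groupI)
  fix z :: "complex ^ 'n" assume z: "z \<in> carrier torus_group"
  show "\<exists>w\<in>carrier torus_group. w \<otimes>\<^bsub>torus_group\<^esub> z = \<one>\<^bsub>torus_group\<^esub>"
    using z torus_nth_nonzero[OF z]
    by (intro bexI[of _ "\<chi> i. inverse (z $ i)"])
      (auto simp: vec_eq_iff torus_carrier_iff norm_inverse)
qed (auto simp: vec_eq_iff torus_carrier_iff norm_mult mult.assoc mult.commute)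

interpretation torus: comm_group torus_group
  by (rule comm_group_torus)

lemma torus_pow_nth:
  assumes z: "z \<in> carrier torus_group"
  shows "(z [^]\<^bsub>torus_group\<^esub> (k :: int)) $ i = z $ i powi k"
proof -
  have step: "(z [^]\<^bsub>torus_group\<^esub> (j + 1)) $ i = (z [^]\<^bsub>torus_group\<^esub> j) $ i * z $ i" for j :: int
    using z by (simp add: torus.int_pow_mult)
  have powi: "z $ i powi (j + 1) = z $ i powi j * z $ i" for j
    using torus_nth_nonzero[OF z] by (simp add: power_int_add_1)
  show ?thesis
  proof (induction k rule: int_induct[where k = 0])
    case base
    show ?case by simp
  next
    case (step1 j)
    then show ?case by (simp only: step powi)
  next
    case (step2 j)
    then show ?case
      using step[of "j - 1"] powi[of "j - 1"] torus_nth_nonzero[OF z, of i] by simp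
  qed
qed

text \<open>The Euclidean distance is at most the sum of the coordinate distances, so every
  coordinate gets an equal share of \<epsilon>.\<close>

lemma dist_vec_less:
  fixes x y :: "'a :: real_normed_vector ^ 'n"
  assumes "\<And>i. dist (x $ i) (y $ i) < \<epsilon> / CARD('n)"
  shows "dist x y < \<epsilon>"
proof -
  have "dist x y \<le> (\<Sum>i\<in>UNIV. dist (x $ i) (y $ i))"
    unfolding dist_vec_def by (rule L2_set_le_sum) simp
  also have "\<dots> < (\<Sum>i\<in>(UNIV :: 'n set). \<epsilon> / CARD('n))"
    by (rule sum_strict_mono) (use assms in auto)
  finally show ?thesis by simp
qed

lemma torus_dist_mult_left:
  assumes "a \<in> carrier torus_group"
  shows "dist (a \<otimes>\<^bsub>torus_group\<^esub> b) (a \<otimes>\<^bsub>torus_group\<^esub> c) = dist b c"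
proof -
  have "dist (a $ i * b $ i) (a $ i * c $ i) = dist (b $ i) (c $ i)" for i
    using assms by (simp add: dist_norm torus_carrier_iff norm_mult flip: right_diff_distrib)
  then show ?thesis
    by (simp add: dist_vec_def)
qed

text \<open>All coordinates of all the \<open>v j\<close> are treated as one finite family, so a
  single exponent serves them together.\<close>

lemma torus_recurrence:
  assumes "finite J" "\<And>j. j \<in> J \<Longrightarrow> v j \<in> carrier (torus_group :: (complex ^ 'n) monoid)" "\<epsilon> > 0"
  obtains k :: int where "k > 0" "\<And>j. j \<in> J \<Longrightarrow> dist (v j [^]\<^bsub>torus_group\<^esub> k) \<one>\<^bsub>torus_group\<^esub> < \<epsilon>"
proof -
  obtain k :: int where k: "k > 0"
    "\<And>p. p \<in> J \<times> (UNIV :: 'n set) \<Longrightarrow> dist ((v (fst p) $ snd p) powi k) 1 < \<epsilon> / CARD('n)"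
    by (rule unit_complex_recurrence[of "J \<times> (UNIV :: 'n set)" "\<lambda>p. v (fst p) $ snd p" "\<epsilon> / CARD('n)"])
      (use assms in \<open>auto simp: torus_carrier_iff\<close>)
  have "dist (v j [^]\<^bsub>torus_group\<^esub> k) \<one>\<^bsub>torus_group\<^esub> < \<epsilon>" if "j \<in> J" for j
    by (rule dist_vec_less) (use k(2)[of "(j, _)"] assms(2)[OF that] that in \<open>auto simp: torus_pow_nth\<close>)
  with k(1) show thesis by (rule that)
qed

definition torus_char :: "('n \<Rightarrow> int) \<Rightarrow> complex ^ 'n \<Rightarrow> complex" where
  "torus_char m z = (\<Prod>i\<in>UNIV. z $ i powi m i)"

lemma torus_char_mult: "torus_char m (z \<otimes>\<^bsub>torus_group\<^esub> w) = torus_char m z * torus_char m w"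
  by (simp add: torus_char_def power_int_mult_distrib prod.distrib)

lemma torus_char_one: "torus_char m \<one>\<^bsub>torus_group\<^esub> = 1"
  by (simp add: torus_char_def)

lemma torus_char_pow:
  "z \<in> carrier torus_group \<Longrightarrow> torus_char m (z [^]\<^bsub>torus_group\<^esub> k) = torus_char (\<lambda>i. k * m i) z"
  by (simp add: torus_char_def torus_pow_nth power_int_mult)

lemma torus_char_scale: "torus_char (\<lambda>i. k * m i) z = torus_char m z powi k"
proof -
  have "(\<Prod>i\<in>A. z $ i powi (m i * k)) = (\<Prod>i\<in>A. z $ i powi m i) powi k" if "finite A" for A
    using that by induction (simp_all add: power_int_mult power_int_mult_distrib)
  from this[of UNIV] show ?thesis
    by (simp add: torus_char_def mult.commute)
qed

lemma torus_char_nontrivial: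
  fixes m :: "'n :: finite \<Rightarrow> int"
  assumes "m i \<noteq> 0"
  obtains z :: "complex ^ 'n" where "z \<in> carrier torus_group" "torus_char m z \<noteq> 1"
proof -
  \<comment> \<open>The power of \<open>cis (pi / m i)\<close> with exponent \<open>m i\<close> is
    -1, and the other coordinates contribute 1.\<close>
  define z :: "complex ^ 'n" where "z = (\<chi> j. if j = i then cis (pi / m i) else 1)"
  have "torus_char m z = (\<Prod>j\<in>UNIV. if j = i then cis (pi / m i) powi m i else 1)"
    unfolding torus_char_def by (rule prod.cong) (auto simp: z_def)
  also have "\<dots> = -1"
    using assms by (simp add: cis_power_int)
  finally have "torus_char m z \<noteq> 1"
    by simp
  moreover have "z \<in> carrier torus_group"
    by (simp add: torus_carrier_iff z_def)
  ultimately show thesis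
    using that by blast
qed

lemma topspace_torus [simp]: "topspace torus_topology = carrier torus_group"
  by (simp add: torus_topology_def)

lemma continuous_map_torus_char: "continuous_map torus_topology euclidean (torus_char m)"
  unfolding torus_topology_def torus_char_def continuous_map_iff_continuous2[symmetric]
  by (auto intro!: continuous_intros simp: torus_nth_nonzero)

text \<open>By Kronecker's theorem such an element has dense powers. Phrased through characters, the
  condition is a countable intersection of open conditions, as Baire's theorem requires.\<close>

definition torus_generator :: "complex ^ 'n \<Rightarrow> bool" where
  "torus_generator z \<longleftrightarrow> z \<in> carrier torus_group \<and> (\<forall>m. torus_char m z = 1 \<longrightarrow> (\<forall>i. m i = 0))"

lemma torus_generator_pow:
  assumes "torus_generator z" "k \<noteq> 0"
  shows "torus_generator (z [^]\<^bsub>torus_group\<^esub> (k :: int))"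
  using assms by (auto simp: torus_generator_def torus_char_pow)

lemma torus_generator_dense:
  fixes z t :: "complex ^ 'n"
  assumes z: "torus_generator z" and t: "t \<in> carrier torus_group" and "\<epsilon> > 0"
  obtains k :: int where "dist (z [^]\<^bsub>torus_group\<^esub> k) t < \<epsilon>"
proof -
  have zT: "z \<in> carrier torus_group"
    using z by (simp add: torus_generator_def)
  obtain k :: int where "\<And>i. i \<in> UNIV \<Longrightarrow> dist (z $ i powi k) (t $ i) < \<epsilon> / CARD('n)"
    by (rule unit_complex_Kronecker[of UNIV "\<lambda>i. z $ i" "\<lambda>i. t $ i" "\<epsilon> / CARD('n)"])
      (use assms zT in \<open>auto simp: torus_carrier_iff torus_generator_def torus_char_def\<close>)
  then have "dist (z [^]\<^bsub>torus_group\<^esub> k) t < \<epsilon>"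
    by (intro dist_vec_less) (simp add: torus_pow_nth zT)
  then show thesis by (rule that)
qed

text \<open>Nonzero powers of a generator are again generators, and the powers of \<open>z\<close>
  are dense; only the exponent 0 needs care.\<close>

lemma torus_generators_dense:
  fixes z t :: "complex ^ 'n"
  assumes z: "torus_generator z" and t: "t \<in> carrier torus_group" and "\<epsilon> > 0"
  obtains s :: "complex ^ 'n" where "torus_generator s" "dist s t < \<epsilon>"
proof -
  have zT: "z \<in> carrier torus_group"
    using z by (simp add: torus_generator_def)
  have half: "\<epsilon> / 2 > 0"
    using \<open>\<epsilon> > 0\<close> by simp
  obtain k :: int where k: "dist (z [^]\<^bsub>torus_group\<^esub> k) t < \<epsilon> / 2"
    by (rule torus_generator_dense[OF z t half])
  show thesis
  proof (cases "k = 0")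
    case False
    then show thesis
      using k \<open>\<epsilon> > 0\<close> by (intro that[OF torus_generator_pow[OF z False]]) simp
  next
    \<comment> \<open>Now \<open>t\<close> is close to the unit, and a positive return time of
      \<open>z\<close> to the unit replaces the exponent 0.\<close>
    case True
    obtain l :: int where l: "l > 0" "dist (z [^]\<^bsub>torus_group\<^esub> l) \<one>\<^bsub>torus_group\<^esub> < \<epsilon> / 2"
      by (rule torus_recurrence[of "{()}" "\<lambda>_. z" "\<epsilon> / 2"]) (use zT half in auto)
    have "dist (z [^]\<^bsub>torus_group\<^esub> l) t < \<epsilon>"
      using l(2) k True dist_triangle_half_r[of "\<one>\<^bsub>torus_group\<^esub>" "z [^]\<^bsub>torus_group\<^esub> l" \<epsilon> t]
      by (simp add: dist_commute)
    then show thesis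
      using l(1) by (intro that[OF torus_generator_pow[OF z]]) auto
  qed
qed

section \<open>Compactness of the torus and continuity of its multiplication\<close>

lemma compact_torus: "compact (carrier (torus_group :: (complex ^ 'n) monoid))"
proof -
  have eq: "carrier (torus_group :: (complex ^ 'n) monoid) = (\<Inter>i. {z. norm (z $ i) = 1})"
    by (auto simp: torus_carrier_iff)
  have "closed (carrier (torus_group :: (complex ^ 'n) monoid))"
    unfolding eq by (intro closed_INT ballI closed_Collect_eq continuous_intros)
  moreover have "norm z \<le> (\<Sum>i\<in>(UNIV :: 'n set). 1)" if "z \<in> carrier torus_group" for z :: "complex ^ 'n"
    using L2_set_le_sum[of UNIV "\<lambda>i. norm (z $ i)"] that
    by (simp add: norm_vec_def torus_carrier_iff)
  then have "bounded (carrier (torus_group :: (complex ^ 'n) monoid))"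
    unfolding bounded_iff by blast
  ultimately show ?thesis
    by (simp add: compact_eq_bounded_closed)
qed

lemma compact_space_torus: "compact_space torus_topology"
  unfolding torus_topology_def
  using compact_torus by (intro compact_space_subtopology) (simp add: compactin_euclidean_iff)

lemma Hausdorff_space_torus: "Hausdorff_space torus_topology"
  unfolding torus_topology_def by (intro Hausdorff_space_subtopology) simp

lemma continuous_map_torus_euclidean:
  "continuous_map X torus_topology f \<Longrightarrow> continuous_map X euclidean f"
  unfolding torus_topology_def by (simp add: continuous_map_in_subtopology)

lemma continuous_map_torus_mult:
  assumes "continuous_map X torus_topology f" "continuous_map X torus_topology h"
  shows "continuous_map X torus_topology (\<lambda>x. f x \<otimes>\<^bsub>torus_group\<^esub> h x)"
proof -
  have "continuous_map X (prod_topology euclidean euclidean) (\<lambda>x. (f x, h x))"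
    using assms by (intro continuous_map_pairedI continuous_map_torus_euclidean)
  moreover have "continuous_map (prod_topology euclidean euclidean) euclidean
      (\<lambda>p. fst p \<otimes>\<^bsub>torus_group\<^esub> (snd p :: complex ^ 'b))"
    unfolding torus_group_def by (auto intro!: continuous_intros)
  ultimately have "continuous_map X euclidean
      ((\<lambda>p. fst p \<otimes>\<^bsub>torus_group\<^esub> snd p) \<circ> (\<lambda>x. (f x, h x)))"
    by (rule continuous_map_compose)
  then have "continuous_map X euclidean (\<lambda>x. f x \<otimes>\<^bsub>torus_group\<^esub> h x)"
    by (simp add: comp_def)
  moreover have "f x \<otimes>\<^bsub>torus_group\<^esub> h x \<in> carrier torus_group" if "x \<in> topspace X" for x
    using assms[THEN continuous_map_funspace] that by (intro torus.m_closed) (auto simp: Pi_iff)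
  ultimately show ?thesis
    by (auto simp: torus_topology_def continuous_map_in_subtopology)
qed

lemma openin_torus_ball:
  assumes "openin torus_topology U" "t \<in> U"
  shows "\<exists>\<epsilon>>0. \<forall>s\<in>carrier torus_group. dist s t < \<epsilon> \<longrightarrow> s \<in> U"
  using assms unfolding torus_topology_def openin_euclidean_subtopology_iff by blast

section \<open>The representation space\<close>

text \<open>Compact subsets of a discrete space are finite, so each subbasic set is a finite
  intersection of preimages under evaluations; conversely, singletons \<open>K\<close> make the
  evaluations continuous.\<close>

lemma compact_open_topology_discrete:
  "compact_open_topology (discrete_topology A) Y = product_topology (\<lambda>_. Y) A"
proof -
  let ?P = "product_topology (\<lambda>_. Y) A"
  let ?B = "{{f. continuous_map (discrete_topology A) Y f \<and> f \<in> extensional (topspace (discrete_topology A)) \<and> f ` K \<subseteq> U}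
      | K U. compactin (discrete_topology A) K \<and> openin Y U}"
  let ?C = "compact_open_topology (discrete_topology A) Y"
  have maps: "{f. continuous_map (discrete_topology A) Y f \<and> f \<in> extensional (topspace (discrete_topology A)) \<and> f ` K \<subseteq> U}
      = {f \<in> topspace ?P. \<forall>x\<in>K. f x \<in> U}" for K U
    by (auto simp: PiE_def Pi_iff)
  have C: "?C = topology_generated_by ?B"
    by (simp add: compact_open_topology_def)
  have "openin ?P W" if "openin ?C W" for W
  proof -
    have "generate_topology_on ?B W"
      using that unfolding C openin_topology_generated_by_iff .
    then show ?thesis
    proof induction
      case (Basis s)
      then obtain K U where K: "finite K" "K \<subseteq> A" and U: "openin Y U"
        and s: "s = {f \<in> topspace ?P. \<forall>x\<in>K. f x \<in> U}"
        unfolding maps by (auto simp: compactin_discrete_topology)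
      \<comment> \<open>The extra factor \<open>topspace ?P\<close> takes care of empty
        \<open>K\<close>.\<close>
      have s_eq: "s = (\<Inter>x\<in>K. {f \<in> topspace ?P. f x \<in> U}) \<inter> topspace ?P"
        using s by auto
      have "openin ?P {f \<in> topspace ?P. f x \<in> U}" if "x \<in> K" for x
        using K U that by (intro openin_continuous_map_preimage[OF continuous_map_product_projection]) auto
      then show ?case
        unfolding s_eq by (intro openin_INT K(1))
    qed auto
  qed
  moreover have "openin ?C W" if "openin ?P W" for W
  proof -
    have gen: "openin ?C {f \<in> topspace ?P. \<forall>x\<in>K. f x \<in> U}"
      if "compactin (discrete_topology A) K" "openin Y U" for K U
    proof -
      have "{f. continuous_map (discrete_topology A) Y f \<and> f \<in> extensional (topspace (discrete_topology A)) \<and> f ` K \<subseteq> U} \<in> ?B"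
        using that by blast
      then have "openin ?C {f. continuous_map (discrete_topology A) Y f
          \<and> f \<in> extensional (topspace (discrete_topology A)) \<and> f ` K \<subseteq> U}"
        unfolding C by (rule topology_generated_by_Basis)
      then show ?thesis
        unfolding maps .
    qed
    have sub: "openin ?C {f \<in> topspace ?P. f x \<in> U}" if "x \<in> A" "openin Y U" for x U
      using gen[of "{x}" U] that by (simp add: compactin_discrete_topology)
    have "openin ?C (topspace ?P)"
      using gen[of "{}" "topspace Y"] by simp
    then have "topspace ?P \<subseteq> topspace ?C"
      by (rule openin_subset)
    moreover have "topspace ?C \<subseteq> topspace ?P"
      unfolding C topology_generated_by_topspace using maps by blast
    ultimately have top: "topspace ?C = topspace ?P"
      by (rule subset_antisym[rotated])
    \<comment> \<open>Continuity of the identity into the product says that every set open in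
      \<open>?P\<close> is open in \<open>?C\<close>.\<close>
    have "continuous_map ?C ?P (\<lambda>f. f)"
      unfolding continuous_map_componentwise
    proof (intro conjI ballI)
      show "(\<lambda>f. f) ` topspace ?C \<subseteq> extensional A"
        unfolding top by (auto simp: PiE_def)
      show "continuous_map ?C Y (\<lambda>f. f x)" if "x \<in> A" for x
        unfolding continuous_map_def top using sub[OF that] that by auto
    qed
    from openin_continuous_map_preimage[OF this that] show ?thesis
      using openin_subset[OF that] top by (simp add: Int_absorb1 Collect_conj_eq)
  qed
  ultimately show ?thesis
    by (auto simp: topology_eq)
qed

section \<open>Representations of the lattice: compactness, coordinates, neighbourhoods\<close>

context symplectic_lattice
begin

definition Rep :: "('a \<Rightarrow> complex ^ 'n) set" where
  "Rep = hom G torus_group \<inter> extensional (carrier G)"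

definition Rep_topology :: "('a \<Rightarrow> complex ^ 'n) topology" where
  "Rep_topology = subtopology (product_topology (\<lambda>_. torus_topology) (carrier G)) Rep"

lemma Rep_closed: "f \<in> Rep \<Longrightarrow> x \<in> carrier G \<Longrightarrow> f x \<in> carrier torus_group"
  by (auto simp: Rep_def hom_def)

lemma Rep_mult:
  "f \<in> Rep \<Longrightarrow> x \<in> carrier G \<Longrightarrow> y \<in> carrier G \<Longrightarrow> f (x \<otimes> y) = f x \<otimes>\<^bsub>torus_group\<^esub> f y"
  by (auto simp: Rep_def hom_def)

lemma Rep_group_hom: "f \<in> Rep \<Longrightarrow> group_hom G torus_group f"
  by (simp add: Rep_def group_hom_def group_hom_axioms_def torus.group_axioms group_axioms)

lemma Rep_pow:
  "f \<in> Rep \<Longrightarrow> x \<in> carrier G \<Longrightarrow> f (x [^] (k :: int)) = f x [^]\<^bsub>torus_group\<^esub> k"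
  by (rule group_hom.hom_int_pow[OF Rep_group_hom])

lemma topspace_Rep_topology [simp]: "topspace Rep_topology = Rep"
  by (auto simp: Rep_topology_def PiE_def Rep_closed) (simp add: Rep_def)

lemma continuous_map_Rep_eval:
  "x \<in> carrier G \<Longrightarrow> continuous_map Rep_topology torus_topology (\<lambda>f. f x)"
  unfolding Rep_topology_def
  by (intro continuous_map_from_subtopology continuous_map_product_projection)

text \<open>Multiplicativity is a family of equations between continuous maps into a Hausdorff
  space, and extensionality is built into the product.\<close>

lemma closedin_Rep:
  "closedin (product_topology (\<lambda>_. torus_topology) (carrier G)) (Rep :: ('a \<Rightarrow> complex ^ 'n) set)"
proof -
  let ?P = "product_topology (\<lambda>_. torus_topology :: (complex ^ 'n) topology) (carrier G)"
  have "Rep = (\<Inter>x\<in>carrier G. \<Inter>y\<in>carrier G.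
      {f \<in> topspace ?P. f (x \<otimes> y) = f x \<otimes>\<^bsub>torus_group\<^esub> f y})" (is "_ = ?R")
  proof (intro subset_antisym subsetI)
    fix f assume "f \<in> ?R"
    moreover from this have "f \<in> topspace ?P"
      using one_closed by blast
    ultimately show "f \<in> Rep"
      by (auto simp: Rep_def hom_def PiE_def)
  qed (auto simp: PiE_def Rep_closed Rep_mult, auto simp: Rep_def)
  moreover have "closedin ?P {f \<in> topspace ?P. f (x \<otimes> y) = f x \<otimes>\<^bsub>torus_group\<^esub> f y}"
    if "x \<in> carrier G" "y \<in> carrier G" for x y
    using that
    by (intro closedin_continuous_maps_eq[OF Hausdorff_space_torus] continuous_map_torus_mult
        continuous_map_product_projection) auto
  then have "closedin ?P ?R"
    using one_closed by (intro closedin_INT) blast+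
  ultimately show ?thesis
    by simp
qed

lemma compact_space_Rep: "compact_space Rep_topology"
  unfolding Rep_topology_def
  by (intro compact_space_subtopology closedin_compact_space closedin_Rep)
    (simp add: compact_space_product_topology compact_space_torus)

lemma Hausdorff_space_Rep: "Hausdorff_space Rep_topology"
  unfolding Rep_topology_def
  by (intro Hausdorff_space_subtopology) (simp add: Hausdorff_space_product_topology Hausdorff_space_torus)

lemma Rep_eqI:
  assumes f: "f \<in> Rep" and h: "h \<in> Rep" and eq: "\<And>i. i < 2 * g \<Longrightarrow> f (e i) = h (e i)"
  shows "f = h"
proof (rule extensionalityI)
  show "f \<in> extensional (carrier G)" "h \<in> extensional (carrier G)"
    using f h by (auto simp: Rep_def)
  interpret f: group_hom G torus_group f by (rule Rep_group_hom[OF f])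
  interpret h: group_hom G torus_group h by (rule Rep_group_hom[OF h])
  have sub: "subgroup {x \<in> carrier G. f x = h x} G"
    by (rule subgroupI) auto
  fix x assume "x \<in> carrier G"
  then obtain k :: "nat \<Rightarrow> int" where "x = finprod G (\<lambda>i. e i [^] k i) {..<2 * g}"
    using ex1_implies_ex[OF basis_ex1] by blast
  moreover have "finprod G (\<lambda>i. e i [^] k i) {..<2 * g} \<in> {x \<in> carrier G. f x = h x}"
    using eq basis_closed by (intro finprod_int_pow_in_subgroup[OF sub]) auto
  ultimately show "f x = h x"
    by simp
qed

definition coords :: "'a \<Rightarrow> nat \<Rightarrow> int" where
  "coords x = (THE k. k \<in> extensional {..<2 * g} \<and> x = finprod G (\<lambda>i. e i [^] k i) {..<2 * g})"

lemma coords: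
  assumes "x \<in> carrier G"
  shows "finprod G (\<lambda>i. e i [^] coords x i) {..<2 * g} = x"
  using theI'[OF basis_ex1[OF assms]] by (simp add: coords_def)

lemma coords_eqI:
  assumes "x = finprod G (\<lambda>i. e i [^] k i) {..<2 * g}" "i < 2 * g"
  shows "coords x i = k i"
proof -
  \<comment> \<open>Uniqueness of coordinates holds among extensional functions, so \<open>k\<close>
    is restricted first.\<close>
  have "x = finprod G (\<lambda>i. e i [^] restrict k {..<2 * g} i) {..<2 * g}"
    unfolding assms(1) by (rule finprod_cong') (auto simp: basis_closed)
  moreover have "x \<in> carrier G"
    unfolding assms(1) by (intro finprod_closed) (auto simp: basis_closed)
  ultimately have "coords x = restrict k {..<2 * g}"
    unfolding coords_def by (intro the1_equality[OF basis_ex1]) auto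
  then show ?thesis
    using assms(2) by simp
qed

text \<open>Freeness of the lattice on its basis: uniqueness of coordinates makes them additive, so
  the product of the powers of the \<open>t i\<close> is a homomorphism.\<close>

lemma ex_Rep:
  assumes t: "\<And>i. i < 2 * g \<Longrightarrow> t i \<in> carrier torus_group"
  obtains f where "f \<in> Rep" "\<And>i. i < 2 * g \<Longrightarrow> f (e i) = t i"
proof -
  define f where "f = (\<lambda>x\<in>carrier G. finprod torus_group
    (\<lambda>i. t i [^]\<^bsub>torus_group\<^esub> coords x i) {..<2 * g})"
  have coords_mult: "coords (x \<otimes> y) i = coords x i + coords y i"
    if "x \<in> carrier G" "y \<in> carrier G" "i < 2 * g" for x y i
  proof (rule coords_eqI)
    have "finprod G (\<lambda>i. e i [^] (coords x i + coords y i)) {..<2 * g} =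
        finprod G (\<lambda>i. e i [^] coords x i \<otimes> e i [^] coords y i) {..<2 * g}"
      by (rule finprod_cong') (auto simp: basis_closed int_pow_mult)
    also have "\<dots> = x \<otimes> y"
      using that by (subst finprod_multf) (auto simp: basis_closed coords)
    finally show "x \<otimes> y = finprod G (\<lambda>i. e i [^] (coords x i + coords y i)) {..<2 * g}"
      by simp
  qed (use that in auto)
  have "f \<in> hom G torus_group"
  proof (rule homI)
    show "f x \<in> carrier torus_group" if "x \<in> carrier G" for x
      using that by (auto simp: f_def t intro!: torus.finprod_closed)
    show "f (x \<otimes> y) = f x \<otimes>\<^bsub>torus_group\<^esub> f y" if "x \<in> carrier G" "y \<in> carrier G" for x y
    proof -
      have "f (x \<otimes> y) = finprod torus_group (\<lambda>i. t i [^]\<^bsub>torus_group\<^esub> coords x i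
          \<otimes>\<^bsub>torus_group\<^esub> t i [^]\<^bsub>torus_group\<^esub> coords y i) {..<2 * g}"
        using that unfolding f_def
        by simp (rule torus.finprod_cong', auto simp: coords_mult t torus.int_pow_mult)
      also have "\<dots> = f x \<otimes>\<^bsub>torus_group\<^esub> f y"
        using that unfolding f_def by (subst torus.finprod_multf) (auto simp: t)
      finally show ?thesis .
    qed
  qed
  moreover have "f (e i) = t i" if i: "i < 2 * g" for i
  proof -
    have "coords (e i) j = (if j = i then 1 else 0)" if "j < 2 * g" for j
    proof (rule coords_eqI)
      have "finprod G (\<lambda>j. e j [^] (if j = i then 1 else 0 :: int)) {..<2 * g} =
          finprod G (\<lambda>j. if i = j then e j else \<one>) {..<2 * g}"
        by (rule finprod_cong') (auto simp: basis_closed)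
      also have "\<dots> = e i"
        using i by (subst finprod_singleton) (auto simp: basis_closed)
      finally show "e i = finprod G (\<lambda>j. e j [^] (if j = i then 1 else 0 :: int)) {..<2 * g}"
        by simp
    qed (rule that)
    then have "finprod torus_group (\<lambda>j. t j [^]\<^bsub>torus_group\<^esub> coords (e i) j) {..<2 * g} =
        finprod torus_group (\<lambda>j. if i = j then t j else \<one>\<^bsub>torus_group\<^esub>) {..<2 * g}"
      by (intro torus.finprod_cong') (auto simp: t)
    also have "\<dots> = t i"
      using i by (subst torus.finprod_singleton) (auto simp: t)
    finally show ?thesis
      using basis_closed[OF i] by (simp add: f_def)
  qed
  ultimately show thesis
    by (intro that[of f]) (auto simp: Rep_def f_def)
qed

text \<open>Evaluation at the basis is a continuous injection from a compact space into a Hausdorff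
  one. The image of the complement of \<open>W\<close> is therefore closed and misses the image of
  \<tau>, so finitely many coordinates control membership in \<open>W\<close>.\<close>

lemma Rep_neighbourhood:
  fixes \<tau> :: "'a \<Rightarrow> complex ^ 'n"
  assumes W: "openin Rep_topology W" and \<tau>: "\<tau> \<in> W"
  shows "\<exists>\<epsilon>>0. \<forall>f\<in>Rep. (\<forall>i<2 * g. dist (f (e i)) (\<tau> (e i)) < \<epsilon>) \<longrightarrow> f \<in> W"
proof -
  let ?P = "product_topology (\<lambda>_. torus_topology) {..<2 * g}"
  define ev where "ev f = (\<lambda>i\<in>{..<2 * g}. f (e i))" for f :: "'a \<Rightarrow> complex ^ 'n"
  have \<tau>_Rep: "\<tau> \<in> Rep"
    using openin_subset[OF W] \<tau> by auto
  have "continuous_map Rep_topology torus_topology (\<lambda>f. ev f i)" if "i < 2 * g" for i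
    using that by (simp add: ev_def continuous_map_Rep_eval basis_closed)
  then have "continuous_map Rep_topology ?P ev"
    unfolding continuous_map_componentwise by (auto simp: ev_def)
  moreover have "closedin Rep_topology (topspace Rep_topology - W)"
    by (intro closedin_diff closedin_topspace W)
  then have "compactin Rep_topology (Rep - W)"
    using closedin_compact_space[OF compact_space_Rep] by simp
  ultimately have "compactin ?P (ev ` (Rep - W))"
    by (intro image_compactin)
  then have "closedin ?P (ev ` (Rep - W))"
    by (intro compactin_imp_closedin) (simp add: Hausdorff_space_product_topology Hausdorff_space_torus)
  then have op: "openin ?P (topspace ?P - ev ` (Rep - W))"
    by blast
  have mem: "ev \<tau> \<in> topspace ?P - ev ` (Rep - W)"
  proof -
    have "ev \<tau> \<noteq> ev f" if "f \<in> Rep - W" for f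
    proof
      assume "ev \<tau> = ev f"
      then have "\<tau> (e i) = f (e i)" if "i < 2 * g" for i
        using that by (auto simp: ev_def dest: fun_cong[of _ _ i])
      then show False
        using Rep_eqI[OF \<tau>_Rep, of f] that \<tau> by auto
    qed
    moreover have "ev \<tau> \<in> topspace ?P"
      using \<tau>_Rep by (auto simp: ev_def Rep_closed basis_closed)
    ultimately show ?thesis
      by auto
  qed
  from op[unfolded openin_product_topology_alt, rule_format, OF mem]
  obtain U where "\<forall>i\<in>{..<2 * g}. openin torus_topology (U i)"
    and U: "ev \<tau> \<in> PiE {..<2 * g} U" "PiE {..<2 * g} U \<subseteq> topspace ?P - ev ` (Rep - W)"
    by (elim exE conjE)
  then have U_open: "openin torus_topology (U i)" if "i < 2 * g" for i
    using that by simp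
  have "\<forall>i\<in>{..<2 * g}. \<exists>\<epsilon>>0. \<forall>s\<in>carrier torus_group. dist s (\<tau> (e i)) < \<epsilon> \<longrightarrow> s \<in> U i"
  proof
    fix i assume "i \<in> {..<2 * g}"
    then have "i < 2 * g" "\<tau> (e i) \<in> U i"
      using U(1) by (auto simp: ev_def PiE_iff)
    then show "\<exists>\<epsilon>>0. \<forall>s\<in>carrier torus_group. dist s (\<tau> (e i)) < \<epsilon> \<longrightarrow> s \<in> U i"
      by (intro openin_torus_ball[OF U_open])
  qed
  from bchoice[OF this] obtain \<epsilon> where \<epsilon>: "\<And>i. i < 2 * g \<Longrightarrow> \<epsilon> i > 0 \<and>
      (\<forall>s\<in>carrier torus_group. dist s (\<tau> (e i)) < \<epsilon> i \<longrightarrow> s \<in> U i)"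
    by auto
  define d where "d = Min (\<epsilon> ` {..<2 * g})"
  have ne: "\<epsilon> ` {..<2 * g} \<noteq> {}"
    using genus_pos by (metis image_is_empty lessThan_iff empty_iff mult_pos_pos zero_less_numeral)
  show ?thesis
  proof (intro exI conjI ballI impI)
    show "d > 0"
      unfolding d_def using ne \<epsilon> by (subst Min_gr_iff) auto
    fix f assume f: "f \<in> Rep" "\<forall>i<2 * g. dist (f (e i)) (\<tau> (e i)) < d"
    have "f (e i) \<in> U i" if "i < 2 * g" for i
    proof -
      have "d \<le> \<epsilon> i"
        unfolding d_def using that by (intro Min_le) auto
      then show ?thesis
        using \<epsilon>[OF that] f that by (force simp: Rep_closed basis_closed)
    qed
    then have "ev f \<in> PiE {..<2 * g} U"
      by (auto simp: ev_def)
    then show "f \<in> W"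
      using U(2) f(1) by auto
  qed
qed

end

section \<open>Density of the orbit\<close>

context symplectic_lattice
begin

text \<open>Precomposition with \<phi> rather than with its inverse avoids inverses in the
  computations; \<open>Orbit_eq_inv\<close> shows that the set is the same.\<close>

definition Orbit :: "('a \<Rightarrow> complex ^ 'n) \<Rightarrow> ('a \<Rightarrow> complex ^ 'n) set" where
  "Orbit \<rho> = (\<lambda>\<phi>. compose (carrier G) \<rho> \<phi>) ` Sp"

lemma Rep_compose_Sp:
  assumes f: "f \<in> Rep" and \<phi>: "\<phi> \<in> Sp"
  shows "compose (carrier G) f \<phi> \<in> Rep"
proof -
  have "\<phi> (x \<otimes> y) = \<phi> x \<otimes> \<phi> y" if "x \<in> carrier G" "y \<in> carrier G" for x y
    using \<phi> that by (auto simp: Sp_def iso_def hom_def)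
  then show ?thesis
    using f Sp_closed[OF \<phi>] by (auto simp: Rep_def hom_def compose_def)
qed

lemma continuous_map_Rep_compose:
  assumes \<phi>: "\<phi> \<in> Sp"
  shows "continuous_map Rep_topology Rep_topology (\<lambda>f. compose (carrier G) f \<phi>)"
proof -
  have "continuous_map Rep_topology torus_topology (\<lambda>f. compose (carrier G) f \<phi> x)"
    if "x \<in> carrier G" for x
    using that by (simp add: compose_def continuous_map_Rep_eval Sp_closed[OF \<phi>])
  then have "continuous_map Rep_topology (product_topology (\<lambda>_. torus_topology) (carrier G))
      (\<lambda>f. compose (carrier G) f \<phi>)"
    unfolding continuous_map_componentwise by (auto simp: compose_def)
  then show ?thesis
    by (subst (2) Rep_topology_def) (auto simp: continuous_map_in_subtopology Rep_compose_Sp[OF _ \<phi>])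
qed

lemma Orbit_subset_Rep: "\<rho> \<in> Rep \<Longrightarrow> Orbit \<rho> \<subseteq> Rep"
  by (auto simp: Orbit_def Rep_compose_Sp)

lemma Orbit_self:
  assumes "\<rho> \<in> Rep"
  shows "\<rho> \<in> Orbit \<rho>"
proof -
  have "(\<lambda>x. x) \<in> Sp"
    by (simp add: Sp_def iso_set_refl)
  moreover have "compose (carrier G) \<rho> (\<lambda>x. x) = \<rho>"
    using assms by (auto simp: Rep_def compose_def extensional_def fun_eq_iff)
  ultimately show ?thesis
    unfolding Orbit_def by (metis imageI)
qed

lemma Orbit_compose:
  assumes "f \<in> Orbit \<rho>" "\<psi> \<in> Sp"
  shows "compose (carrier G) f \<psi> \<in> Orbit \<rho>"
proof -
  obtain \<phi> where \<phi>: "\<phi> \<in> Sp" "f = compose (carrier G) \<rho> \<phi>"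
    using assms(1) by (auto simp: Orbit_def)
  have "compose (carrier G) f \<psi> = compose (carrier G) \<rho> (\<phi> \<circ> \<psi>)"
    using Sp_closed[OF assms(2)] by (auto simp: \<phi>(2) compose_def fun_eq_iff)
  then show ?thesis
    using Sp_comp[OF assms(2) \<phi>(1)] by (auto simp: Orbit_def)
qed

text \<open>Symplectic maps are bijective. Thus a dense image is inherited by all points of the
  orbit, and values of orbit points are values of \<rho>.\<close>

lemma Orbit_image:
  assumes "f \<in> Orbit \<rho>"
  shows "f ` carrier G = \<rho> ` carrier G"
proof -
  obtain \<phi> where \<phi>: "\<phi> \<in> Sp" "f = compose (carrier G) \<rho> \<phi>"
    using assms by (auto simp: Orbit_def)
  then have "f ` carrier G = \<rho> ` \<phi> ` carrier G"
    by (auto simp: compose_def image_image)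
  then show ?thesis
    using Sp_bij[OF \<phi>(1)] by (simp add: bij_betw_def)
qed

lemma Orbit_eq_inv:
  "Orbit \<rho> = (\<lambda>\<phi>. compose (carrier G) \<rho> (inv_into (carrier G) \<phi>)) ` Sp"
proof (intro subset_antisym subsetI)
  fix f assume "f \<in> Orbit \<rho>"
  then obtain \<phi> where \<phi>: "\<phi> \<in> Sp" "f = compose (carrier G) \<rho> \<phi>"
    by (auto simp: Orbit_def)
  have "inv_into (carrier G) (inv_into (carrier G) \<phi>) x = \<phi> x" if "x \<in> carrier G" for x
    using inv_into_inv_into_eq[OF Sp_bij[OF \<phi>(1)] that] .
  then have "f = compose (carrier G) \<rho> (inv_into (carrier G) (inv_into (carrier G) \<phi>))"
    by (auto simp: \<phi>(2) compose_def fun_eq_iff)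
  then show "f \<in> (\<lambda>\<phi>. compose (carrier G) \<rho> (inv_into (carrier G) \<phi>)) ` Sp"
    using Sp_inv[OF \<phi>(1)] by blast
next
  fix f assume "f \<in> (\<lambda>\<phi>. compose (carrier G) \<rho> (inv_into (carrier G) \<phi>)) ` Sp"
  then show "f \<in> Orbit \<rho>"
    by (auto simp: Orbit_def Sp_inv)
qed

lemma Orbit_closure_compose:
  assumes \<rho>: "\<rho> \<in> Rep" and f: "f \<in> Rep_topology closure_of Orbit \<rho>" and \<phi>: "\<phi> \<in> Sp"
  shows "compose (carrier G) f \<phi> \<in> Rep_topology closure_of Orbit \<rho>"
proof -
  have "compose (carrier G) f \<phi> \<in> Rep_topology closure_of (\<lambda>f. compose (carrier G) f \<phi>) ` Orbit \<rho>"
    using continuous_map_image_closure_subset[OF continuous_map_Rep_compose[OF \<phi>], of "Orbit \<rho>"] f by blast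
  moreover have "(\<lambda>f. compose (carrier G) f \<phi>) ` Orbit \<rho> \<subseteq> Orbit \<rho>"
    using Orbit_compose[OF _ \<phi>] by blast
  ultimately show ?thesis
    using closure_of_mono by blast
qed

text \<open>If all values at basis elements had finite order, then with \<open>Q\<close> the product
  of suitable exponents the nontrivial character \<open>Q m\<close> would be trivial on the image,
  and by continuity on the whole torus.\<close>

lemma ex_basis_char_infinite_order:
  fixes f :: "'a \<Rightarrow> complex ^ 'n"
  assumes f: "f \<in> Rep" and dense: "torus_topology closure_of (f ` carrier G) = carrier torus_group"
    and m: "m l \<noteq> 0"
  shows "\<exists>i<2 * g. \<forall>q :: int. q \<noteq> 0 \<longrightarrow> torus_char m (f (e i)) powi q \<noteq> 1"
proof (rule ccontr)
  assume "\<not> ?thesis"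
  then have "\<forall>i\<in>{..<2 * g}. \<exists>q :: int. q \<noteq> 0 \<and> torus_char m (f (e i)) powi q = 1"
    by auto
  from bchoice[OF this] obtain q :: "nat \<Rightarrow> int"
    where q: "\<And>i. i < 2 * g \<Longrightarrow> q i \<noteq> 0 \<and> torus_char m (f (e i)) powi q i = 1"
    by auto
  define Q where "Q = (\<Prod>i<2 * g. q i)"
  have Q0: "Q \<noteq> 0"
    using q by (simp add: Q_def)
  define \<chi>Q where "\<chi>Q = (torus_char (\<lambda>i. Q * m i) :: complex ^ 'n \<Rightarrow> complex)"
  have basis: "\<chi>Q (f (e i)) = 1" if i: "i < 2 * g" for i
  proof -
    have "q i dvd Q"
      unfolding Q_def using i by (intro dvd_prodI) auto
    then obtain r where "Q = q i * r"
      by (rule dvdE)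
    then show ?thesis
      using q[OF i] by (simp add: \<chi>Q_def torus_char_scale power_int_mult)
  qed
  interpret f: group_hom G torus_group f by (rule Rep_group_hom[OF f])
  have inv: "\<chi>Q (inv\<^bsub>torus_group\<^esub> z) = 1" if "z \<in> carrier torus_group" "\<chi>Q z = 1" for z
    using torus_char_mult[of "\<lambda>i. Q * m i" "inv\<^bsub>torus_group\<^esub> z" z] that
    by (simp add: \<chi>Q_def torus_char_one)
  have sub: "subgroup {x \<in> carrier G. \<chi>Q (f x) = 1} G"
  proof (rule subgroupI)
    show "{x \<in> carrier G. \<chi>Q (f x) = 1} \<noteq> {}"
      using f.hom_one one_closed by (auto simp: \<chi>Q_def torus_char_one intro!: exI[of _ \<one>])
  qed (auto simp: inv, auto simp: \<chi>Q_def torus_char_mult)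
  have one: "\<chi>Q (f x) = 1" if "x \<in> carrier G" for x
  proof -
    have "finprod G (\<lambda>i. e i [^] coords x i) {..<2 * g} \<in> {x \<in> carrier G. \<chi>Q (f x) = 1}"
      using basis basis_closed by (intro finprod_int_pow_in_subgroup[OF sub]) auto
    then show ?thesis
      by (simp add: coords[OF that])
  qed
  have "closedin torus_topology {z \<in> topspace torus_topology. \<chi>Q z \<in> {1}}"
    unfolding \<chi>Q_def by (rule closedin_continuous_map_preimage[OF continuous_map_torus_char]) simp
  moreover have "f ` carrier G \<subseteq> {z \<in> topspace torus_topology. \<chi>Q z \<in> {1}}"
    using one by auto
  ultimately have "carrier torus_group \<subseteq> {z \<in> topspace torus_topology. \<chi>Q z \<in> {1}}"
    unfolding dense[symmetric] by (rule closure_of_minimal[rotated])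
  moreover have "Q * m l \<noteq> 0"
    using Q0 m by simp
  then obtain z where "z \<in> carrier torus_group" "\<chi>Q z \<noteq> 1"
    unfolding \<chi>Q_def by (rule torus_char_nontrivial[of "\<lambda>i. Q * m i" l])
  ultimately show False
    by auto
qed

lemma shear_eval:
  assumes "f \<in> Rep" "N \<in> hom G G" "x \<in> carrier G"
  shows "compose (carrier G) f (\<lambda>x. x \<otimes> N x [^] (k :: int)) x =
    f x \<otimes>\<^bsub>torus_group\<^esub> f (N x) [^]\<^bsub>torus_group\<^esub> k"
proof -
  have "N x \<in> carrier G"
    using assms by (auto simp: hom_def)
  then show ?thesis
    using assms by (simp add: compose_def Rep_mult Rep_pow)
qed

lemma zero_less_two_genus: "0 < 2 * g"
  using genus_pos by simp

lemma ex_generator_in_Orbit_closure: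
  fixes \<rho> :: "'a \<Rightarrow> complex ^ 'n"
  assumes \<rho>: "\<rho> \<in> Rep" and dense: "torus_topology closure_of (\<rho> ` carrier G) = carrier torus_group"
  obtains f where "f \<in> Rep_topology closure_of Orbit \<rho>" "torus_generator (f (e 0))"
proof -
  let ?X = "Rep_topology closure_of Orbit \<rho>"
  let ?T = "subtopology Rep_topology ?X"
  \<comment> \<open>The open set, to be shown dense for \<open>m\<close> nonzero, of points at which
    \<open>m\<close> does not kill the value at \<open>e 0\<close>.\<close>
  define U where "U m = {f \<in> topspace ?T. torus_char m (f (e 0)) \<in> - {1}}" for m :: "'n \<Rightarrow> int"
  have X_Rep: "?X \<subseteq> Rep"
    using closure_of_subset_topspace[of Rep_topology "Orbit \<rho>"] by simp
  have Orbit_X: "Orbit \<rho> \<subseteq> ?X"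
    by (rule closure_of_subset) (simp add: Orbit_subset_Rep \<rho>)
  have top: "topspace ?T = ?X"
    using X_Rep by auto
  have e0: "e 0 \<in> carrier G"
    using basis_closed zero_less_two_genus by blast
  have "openin ?T (U m)" for m
  proof -
    have "continuous_map ?T torus_topology (\<lambda>f. f (e 0))"
      by (intro continuous_map_from_subtopology continuous_map_Rep_eval e0)
    then have "continuous_map ?T euclidean (torus_char m \<circ> (\<lambda>f. f (e 0)))"
      by (rule continuous_map_compose) (rule continuous_map_torus_char)
    then show ?thesis
      unfolding U_def by (auto dest: openin_continuous_map_preimage[where U = "- {1}"] simp: comp_def open_Compl)
  qed
  moreover have "?T closure_of (U m) = topspace ?T" if m: "m l \<noteq> 0" for m l
    unfolding dense_intersects_open
  proof (intro allI impI)
    fix V assume "openin ?T V \<and> V \<noteq> {}"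
    then obtain W f0 where W: "openin Rep_topology W" "V = W \<inter> ?X" and "f0 \<in> W" "f0 \<in> ?X"
      unfolding openin_subtopology by blast
    \<comment> \<open>An open set meeting the closure meets the orbit itself, and for orbit points
      the image is known to be dense.\<close>
    then obtain f where f: "f \<in> Orbit \<rho>" "f \<in> W"
      unfolding in_closure_of by blast
    have fR: "f \<in> Rep"
      using f(1) Orbit_subset_Rep[OF \<rho>] by blast
    have "\<exists>h. h \<in> Orbit \<rho> \<and> h \<in> W \<and> torus_char m (h (e 0)) \<noteq> 1"
    proof (cases "torus_char m (f (e 0)) = 1")
      case False
      then show ?thesis using f by blast
    next
      case True
      have "torus_topology closure_of (f ` carrier G) = carrier torus_group"
        by (simp add: Orbit_image[OF f(1)] dense)
      from ex_basis_char_infinite_order[where m = m and l = l, OF fR this m] obtain i where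
        i: "i < 2 * g" "\<And>q :: int. q \<noteq> 0 \<Longrightarrow> torus_char m (f (e i)) powi q \<noteq> 1"
        by auto
      \<comment> \<open>The value of \<open>m\<close> at \<open>f (e 0)\<close> is 1, at
        \<open>f (e i)\<close> of infinite order.\<close>
      have i0: "0 \<noteq> i"
      proof
        assume "0 = i"
        then show False
          using i(2)[of 1] True by simp
      qed
      obtain N c where N: "N \<in> hom G G" "c \<noteq> 0" "N (e 0) = e i [^] (c :: int)"
        "\<And>k :: int. (\<lambda>x. x \<otimes> N x [^] k) \<in> Sp"
        using exists_shear[OF i(1) zero_less_two_genus i0] by (elim exE conjE) auto
      obtain \<epsilon> where \<epsilon>: "\<epsilon> > 0"
        "\<forall>h\<in>Rep. (\<forall>j<2 * g. dist (h (e j)) (f (e j)) < \<epsilon>) \<longrightarrow> h \<in> W"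
        using Rep_neighbourhood[OF W(1) f(2)] by (elim exE conjE) auto
      have Nf: "f (N (e j)) \<in> carrier torus_group" if "j < 2 * g" for j
        using N(1) basis_closed[OF that] by (auto simp: hom_def intro!: Rep_closed[OF fR])
      \<comment> \<open>A return time at which the shear displaces every basis value by less than
        \<epsilon>, so that \<open>h\<close> stays in \<open>W\<close>. Being nonzero,
        \<open>c * k\<close> still changes the character value at \<open>e 0\<close>.\<close>
      obtain k :: int where k: "k > 0"
        "\<And>j. j \<in> {..<2 * g} \<Longrightarrow> dist (f (N (e j)) [^]\<^bsub>torus_group\<^esub> k) \<one>\<^bsub>torus_group\<^esub> < \<epsilon>"
        by (rule torus_recurrence[of "{..<2 * g}" "\<lambda>j. f (N (e j))" \<epsilon>]) (use Nf \<epsilon>(1) in auto)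
      define h where "h = compose (carrier G) f (\<lambda>x. x \<otimes> N x [^] k)"
      have h: "h \<in> Orbit \<rho>"
        unfolding h_def by (rule Orbit_compose[OF f(1) N(4)])
      have h_e: "h (e j) = f (e j) \<otimes>\<^bsub>torus_group\<^esub> f (N (e j)) [^]\<^bsub>torus_group\<^esub> k" if "j < 2 * g" for j
        unfolding h_def by (rule shear_eval[OF fR N(1) basis_closed[OF that]])
      have "dist (h (e j)) (f (e j)) < \<epsilon>" if "j < 2 * g" for j
      proof -
        have fe: "f (e j) \<in> carrier torus_group"
          by (rule Rep_closed[OF fR basis_closed[OF that]])
        show ?thesis
          using torus_dist_mult_left[OF fe, of "f (N (e j)) [^]\<^bsub>torus_group\<^esub> k" "\<one>\<^bsub>torus_group\<^esub>"] fe k(2)[of j] that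
          by (simp add: h_e)
      qed
      then have "h \<in> W"
        using \<epsilon>(2) h Orbit_subset_Rep[OF \<rho>] by blast
      moreover have "torus_char m (h (e 0)) \<noteq> 1"
      proof -
        have ei: "e i \<in> carrier G"
          by (rule basis_closed[OF i(1)])
        have "h (e 0) = f (e 0) \<otimes>\<^bsub>torus_group\<^esub> f (e i) [^]\<^bsub>torus_group\<^esub> (c * k)"
          using h_e[OF zero_less_two_genus] ei
          by (simp add: N(3) Rep_pow[OF fR] torus.int_pow_pow Rep_closed[OF fR])
        then have "torus_char m (h (e 0)) = torus_char m (f (e i)) powi (c * k)"
          using True ei by (simp add: torus_char_mult torus_char_pow torus_char_scale Rep_closed[OF fR])
        then show ?thesis
          using i(2)[of "c * k"] N(2) k(1) by simp
      qed
      ultimately show ?thesis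
        using h by blast
    qed
    then obtain h where "h \<in> Orbit \<rho>" "h \<in> W" "torus_char m (h (e 0)) \<noteq> 1"
      by blast
    then have "h \<in> U m \<inter> V"
      using Orbit_X X_Rep by (auto simp: U_def W(2))
    then show "U m \<inter> V \<noteq> {}"
      by blast
  qed
  moreover have "locally_compact_space ?T \<and> regular_space ?T"
  proof -
    have "compact_space ?T"
      by (intro compact_space_subtopology closedin_compact_space compact_space_Rep closedin_closure_of)
    moreover have "Hausdorff_space ?T"
      by (intro Hausdorff_space_subtopology Hausdorff_space_Rep)
    ultimately show ?thesis
      by (simp add: compact_imp_locally_compact_space compact_Hausdorff_imp_regular_space)
  qed
  \<comment> \<open>The family is countable because the exponents are integer vectors over a finite
    index type.\<close>
  ultimately have "?T closure_of \<Inter> (U ` {m. \<exists>l. m l \<noteq> 0}) = topspace ?T"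
    by (intro Baire_category) auto
  moreover have "topspace ?T \<noteq> {}"
    using Orbit_self[OF \<rho>] Orbit_X top by auto
  ultimately have "\<Inter> (U ` {m. \<exists>l. m l \<noteq> 0}) \<noteq> {}"
    by (metis closure_of_empty)
  then obtain f where "f \<in> \<Inter> (U ` {m. \<exists>l. m l \<noteq> 0})"
    by (meson ex_in_conv)
  then have f: "f \<in> U m" if "m l \<noteq> 0" for m l
    using that by auto
  \<comment> \<open>Any nonzero exponent vector serves here; only membership in the space is
    extracted.\<close>
  have "f \<in> ?X"
    using f[of "\<lambda>_. 1"] top by (simp add: U_def)
  moreover from this have "f (e 0) \<in> carrier torus_group"
    using X_Rep e0 by (blast intro: Rep_closed)
  then have "torus_generator (f (e 0))"
    using f by (auto simp: torus_generator_def U_def)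
  ultimately show thesis
    by (rule that)
qed

text \<open>Shearing \<open>e i\<close> along \<open>e p\<close> multiplies its value by powers of
  \<open>f (e p) [^] c\<close>, again a generator, so the powers come close to the required
  correction \<open>?s\<close>. The case \<open>i = dual_index p\<close> is included.\<close>

lemma adjust_coordinate:
  assumes \<rho>: "\<rho> \<in> Rep" and f: "f \<in> Rep_topology closure_of Orbit \<rho>"
    and p: "p < 2 * g" "torus_generator (f (e p))" and i: "i < 2 * g" "i \<noteq> p"
    and t: "t \<in> carrier torus_group" and "\<epsilon> > 0"
  shows "\<exists>h \<in> Rep_topology closure_of Orbit \<rho>. dist (h (e i)) t < \<epsilon> \<and>
    (\<forall>j<2 * g. j \<noteq> i \<longrightarrow> j \<noteq> dual_index p \<longrightarrow> h (e j) = f (e j))"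
proof -
  have fR: "f \<in> Rep"
    using f closure_of_subset_topspace[of Rep_topology "Orbit \<rho>"] by auto
  have ep: "f (e p) \<in> carrier torus_group" and ei: "f (e i) \<in> carrier torus_group"
    using fR p i by (auto intro: Rep_closed basis_closed)
  obtain N c where N: "N \<in> hom G G" "c \<noteq> 0" "N (e i) = e p [^] (c :: int)"
    "\<And>j. \<lbrakk>j < 2 * g; j \<noteq> i; j \<noteq> dual_index p\<rbrakk> \<Longrightarrow> N (e j) = \<one>"
    "\<And>k :: int. (\<lambda>x. x \<otimes> N x [^] k) \<in> Sp"
    using exists_shear[OF p(1) i] by (elim exE conjE) auto
  let ?z = "f (e p) [^]\<^bsub>torus_group\<^esub> c"
  let ?s = "inv\<^bsub>torus_group\<^esub> f (e i) \<otimes>\<^bsub>torus_group\<^esub> t"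
  have "?s \<in> carrier torus_group"
    using ei t by simp
  then obtain k :: int where k: "dist (?z [^]\<^bsub>torus_group\<^esub> k) ?s < \<epsilon>"
    using torus_generator_dense[OF torus_generator_pow[OF p(2) N(2)] _ \<open>\<epsilon> > 0\<close>] by metis
  define h where "h = compose (carrier G) f (\<lambda>x. x \<otimes> N x [^] k)"
  have h_e: "h (e j) = f (e j) \<otimes>\<^bsub>torus_group\<^esub> f (N (e j)) [^]\<^bsub>torus_group\<^esub> k" if "j < 2 * g" for j
    unfolding h_def by (rule shear_eval[OF fR N(1) basis_closed[OF that]])
  have "h \<in> Rep_topology closure_of Orbit \<rho>"
    unfolding h_def by (rule Orbit_closure_compose[OF \<rho> f N(5)])
  moreover have "dist (h (e i)) t < \<epsilon>"
  proof -
    have "f (e i) \<otimes>\<^bsub>torus_group\<^esub> ?s = t"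
      using ei t by (simp flip: torus.m_assoc)
    moreover have "h (e i) = f (e i) \<otimes>\<^bsub>torus_group\<^esub> ?z [^]\<^bsub>torus_group\<^esub> k"
      using h_e[OF i(1)] p by (simp add: N(3) Rep_pow[OF fR] basis_closed)
    ultimately show ?thesis
      using k torus_dist_mult_left[OF ei, of "?z [^]\<^bsub>torus_group\<^esub> k" ?s] by simp
  qed
  moreover have "h (e j) = f (e j)" if j: "j < 2 * g" "j \<noteq> i" "j \<noteq> dual_index p" for j
  proof -
    have "f \<one> = \<one>\<^bsub>torus_group\<^esub>"
      by (rule group_hom.hom_one[OF Rep_group_hom[OF fR]])
    then show ?thesis
      using h_e[OF j(1)] N(4)[OF j] Rep_closed[OF fR basis_closed[OF j(1)]] by simp
  qed
  ultimately show ?thesis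
    by blast
qed

text \<open>Coordinates are set one after another. Each shear may disturb the partner of
  \<open>e p\<close>, which is therefore left out, but it keeps the pivot value and the coordinates
  already set.\<close>

lemma adjust_coordinates:
  assumes \<rho>: "\<rho> \<in> Rep" and f: "f \<in> Rep_topology closure_of Orbit \<rho>"
    and p: "p < 2 * g" "torus_generator (f (e p))"
    and "finite I" and "I \<subseteq> {..<2 * g} - {p, dual_index p}"
    and t: "\<And>i. i \<in> I \<Longrightarrow> t i \<in> carrier torus_group" and "\<epsilon> > 0"
  shows "\<exists>h \<in> Rep_topology closure_of Orbit \<rho>.
    h (e p) = f (e p) \<and> (\<forall>i\<in>I. dist (h (e i)) (t i) < \<epsilon>)"
  using \<open>finite I\<close> \<open>I \<subseteq> _\<close> t
proof (induction I rule: finite_induct)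
  case empty
  show ?case using f by auto
next
  case (insert i I)
  then obtain h where h: "h \<in> Rep_topology closure_of Orbit \<rho>" "h (e p) = f (e p)"
    "\<And>j. j \<in> I \<Longrightarrow> dist (h (e j)) (t j) < \<epsilon>"
    by auto
  have i: "i < 2 * g" "i \<noteq> p" "t i \<in> carrier torus_group"
    using insert.prems by auto
  have gen: "torus_generator (h (e p))"
    using p h by simp
  obtain h' where h': "h' \<in> Rep_topology closure_of Orbit \<rho>" "dist (h' (e i)) (t i) < \<epsilon>"
    "\<And>j. \<lbrakk>j < 2 * g; j \<noteq> i; j \<noteq> dual_index p\<rbrakk> \<Longrightarrow> h' (e j) = h (e j)"
    using adjust_coordinate[OF \<rho> h(1) p(1) gen i \<open>\<epsilon> > 0\<close>] by (elim bexE conjE) auto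
  have "h' (e p) = f (e p)"
    using h'(3)[OF p(1)] i(2) dual_index_neq[OF p(1)] h(2) by simp
  moreover have "dist (h' (e j)) (t j) < \<epsilon>" if "j \<in> insert i I" for j
  proof (cases "j = i")
    case False
    then have "h' (e j) = h (e j)"
      using that insert.prems by (intro h'(3)) auto
    then show ?thesis
      using h(3)[of j] that False by simp
  qed (simp add: h'(2))
  ultimately show ?case
    using h'(1) by blast
qed

text \<open>A generator at the pivot \<open>e p\<close> frees all other coordinates. The closure is
  closed, so approximating \<tau> by its points suffices.\<close>

lemma Orbit_closure_fill:
  assumes \<rho>: "\<rho> \<in> Rep" and f: "f \<in> Rep_topology closure_of Orbit \<rho>"
    and p: "p < 2 * g" "torus_generator (f (e p))"
    and \<tau>: "\<tau> \<in> Rep" "\<tau> (e p) = f (e p)"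
  shows "\<tau> \<in> Rep_topology closure_of Orbit \<rho>"
proof -
  let ?X = "Rep_topology closure_of Orbit \<rho>"
  have "\<exists>h. h \<in> ?X \<and> h \<in> W" if W: "\<tau> \<in> W" "openin Rep_topology W" for W
  proof -
    obtain \<epsilon> where \<epsilon>: "\<epsilon> > 0"
      "\<forall>h\<in>Rep. (\<forall>j<2 * g. dist (h (e j)) (\<tau> (e j)) < \<epsilon>) \<longrightarrow> h \<in> W"
      using Rep_neighbourhood[OF W(2,1)] by (elim exE conjE) auto
    have \<tau>_closed: "\<tau> (e j) \<in> carrier torus_group" if "j < 2 * g" for j
      by (rule Rep_closed[OF \<tau>(1) basis_closed[OF that]])
    obtain h where h: "h \<in> ?X" "h (e p) = f (e p)"
      "\<forall>i \<in> {..<2 * g} - {p, dual_index p}. dist (h (e i)) (\<tau> (e i)) < \<epsilon>"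
      using adjust_coordinates[OF \<rho> f p, of "{..<2 * g} - {p, dual_index p}" "\<lambda>i. \<tau> (e i)" \<epsilon>] \<tau>_closed \<epsilon>(1)
      by auto
    have gen: "torus_generator (h (e p))"
      using p h by simp
    \<comment> \<open>The partner of \<open>e p\<close> comes last: its own shear moves no other
      basis element.\<close>
    obtain h' where h': "h' \<in> ?X" "dist (h' (e (dual_index p))) (\<tau> (e (dual_index p))) < \<epsilon>"
      "\<And>j. \<lbrakk>j < 2 * g; j \<noteq> dual_index p\<rbrakk> \<Longrightarrow> h' (e j) = h (e j)"
      using adjust_coordinate[OF \<rho> h(1) p(1) gen dual_index_less[OF p(1)] dual_index_neq[OF p(1)]
          \<tau>_closed[OF dual_index_less[OF p(1)]] \<epsilon>(1)] by (elim bexE conjE) auto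
    have "dist (h' (e j)) (\<tau> (e j)) < \<epsilon>" if j: "j < 2 * g" for j
    proof (cases "j = dual_index p")
      case True
      then show ?thesis using h'(2) by simp
    next
      case False
      then have "h' (e j) = h (e j)"
        using h'(3) j by simp
      then show ?thesis
        using h(2,3) \<tau>(2) \<epsilon>(1) j False by (cases "j = p") auto
    qed
    moreover have "h' \<in> Rep"
      using h'(1) closure_of_subset_topspace[of Rep_topology "Orbit \<rho>"] by auto
    ultimately show ?thesis
      using \<epsilon>(2) h'(1) by blast
  qed
  then have "\<tau> \<in> Rep_topology closure_of ?X"
    using \<tau>(1) unfolding in_closure_of by auto
  then show ?thesis
    by simp
qed

text \<open>Forward, two fillings suffice: the pivot \<open>e 0\<close> places a generator at its
  partner, which then becomes the pivot and frees the value at \<open>e 0\<close>. Backward,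
  evaluation at \<open>e 0\<close> sends the orbit into the image of \<rho>.\<close>

theorem Orbit_dense_iff:
  fixes \<rho> :: "'a \<Rightarrow> complex ^ 'n"
  assumes \<rho>: "\<rho> \<in> Rep"
  shows "torus_topology closure_of (\<rho> ` carrier G) = topspace torus_topology \<longleftrightarrow>
    Rep_topology closure_of Orbit \<rho> = topspace Rep_topology"
proof
  let ?X = "Rep_topology closure_of Orbit \<rho>"
  assume "torus_topology closure_of (\<rho> ` carrier G) = topspace torus_topology"
  then have "torus_topology closure_of (\<rho> ` carrier G) = carrier torus_group"
    by simp
  then obtain f where f: "f \<in> ?X" "torus_generator (f (e 0))"
    by (rule ex_generator_in_Orbit_closure[OF \<rho>])
  let ?b = "dual_index 0"
  have b: "?b < 2 * g" "?b \<noteq> 0"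
    using dual_index_less[OF zero_less_two_genus] dual_index_neq[OF zero_less_two_genus] by auto
  have f0: "f (e 0) \<in> carrier torus_group"
    using f(2) by (simp add: torus_generator_def)
  have "\<tau> \<in> ?X" if \<tau>: "\<tau> \<in> Rep" for \<tau>
  proof -
    have \<tau>_closed: "\<tau> (e j) \<in> carrier torus_group" if "j < 2 * g" for j
      by (rule Rep_closed[OF \<tau> basis_closed[OF that]])
    have "\<exists>h. h \<in> ?X \<and> h \<in> W" if W: "\<tau> \<in> W" "openin Rep_topology W" for W
    proof -
      obtain \<epsilon> where \<epsilon>: "\<epsilon> > 0"
        "\<forall>h\<in>Rep. (\<forall>j<2 * g. dist (h (e j)) (\<tau> (e j)) < \<epsilon>) \<longrightarrow> h \<in> W"
        using Rep_neighbourhood[OF W(2,1)] by (elim exE conjE) auto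
      \<comment> \<open>The value of \<tau> at the partner need not be a generator, so a nearby
        generator takes its place.\<close>
      obtain s where s: "torus_generator s" "dist s (\<tau> (e ?b)) < \<epsilon>"
        by (rule torus_generators_dense[OF f(2) \<tau>_closed[OF b(1)] \<epsilon>(1)])
      have sT: "s \<in> carrier torus_group"
        using s(1) by (simp add: torus_generator_def)
      \<comment> \<open>An intermediate point with the old value at \<open>e 0\<close> and the new
        pivot value \<open>s\<close> at its partner.\<close>
      obtain f1 where f1: "f1 \<in> Rep" "\<And>i. i < 2 * g \<Longrightarrow>
          f1 (e i) = (if i = 0 then f (e 0) else if i = ?b then s else \<tau> (e i))"
        by (rule ex_Rep[of "\<lambda>i. if i = 0 then f (e 0) else if i = ?b then s else \<tau> (e i)"])
          (use f0 sT \<tau>_closed in auto)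
      have f1X: "f1 \<in> ?X"
        using f1(2)[OF zero_less_two_genus]
        by (intro Orbit_closure_fill[OF \<rho> f(1) zero_less_two_genus f(2) f1(1)]) simp
      have f1b: "f1 (e ?b) = s"
        using f1(2)[OF b(1)] b(2) by simp
      \<comment> \<open>It shares the value \<open>s\<close> with \<open>f1\<close> and differs from
        \<tau> only at the partner, by less than \<epsilon>.\<close>
      obtain f2 where f2: "f2 \<in> Rep" "\<And>i. i < 2 * g \<Longrightarrow>
          f2 (e i) = (if i = ?b then s else \<tau> (e i))"
        by (rule ex_Rep[of "\<lambda>i. if i = ?b then s else \<tau> (e i)"]) (use sT \<tau>_closed in auto)
      have "f2 \<in> ?X"
        using s(1) f2(2)[OF b(1)] f1b by (intro Orbit_closure_fill[OF \<rho> f1X b(1) _ f2(1)]) auto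
      moreover have "f2 \<in> W"
        using f2 s(2) \<epsilon> by auto
      ultimately show ?thesis
        by blast
    qed
    then have "\<tau> \<in> Rep_topology closure_of ?X"
      using \<tau> unfolding in_closure_of by auto
    then show ?thesis
      by simp
  qed
  then show "?X = topspace Rep_topology"
    using closure_of_subset_topspace[of Rep_topology "Orbit \<rho>"] by auto
next
  assume dense: "Rep_topology closure_of Orbit \<rho> = topspace Rep_topology"
  show "torus_topology closure_of (\<rho> ` carrier G) = topspace torus_topology"
    unfolding dense_intersects_open
  proof (intro allI impI)
    fix U :: "(complex ^ 'n) set" assume U: "openin torus_topology U \<and> U \<noteq> {}"
    then obtain t where t: "t \<in> U" "t \<in> carrier torus_group"
      using openin_subset by force
    have e0: "e 0 \<in> carrier G"
      by (rule basis_closed[OF zero_less_two_genus])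
    \<comment> \<open>The representation equal to \<open>t\<close> on the basis shows that the
      cylinder \<open>?W\<close> over \<open>U\<close> is nonempty.\<close>
    obtain \<tau> where \<tau>: "\<tau> \<in> Rep" "\<And>i. i < 2 * g \<Longrightarrow> \<tau> (e i) = t"
      by (rule ex_Rep[of "\<lambda>_. t"]) (use t in auto)
    let ?W = "{f \<in> topspace Rep_topology. f (e 0) \<in> U}"
    have "openin Rep_topology ?W"
      using U by (intro openin_continuous_map_preimage[OF continuous_map_Rep_eval[OF e0]]) simp
    moreover have "\<tau> \<in> ?W"
      using \<tau> t zero_less_two_genus by simp
    ultimately obtain f where f: "f \<in> Orbit \<rho>" "f (e 0) \<in> U"
      using dense unfolding dense_intersects_open by blast
    have "f (e 0) \<in> \<rho> ` carrier G"
      using Orbit_image[OF f(1)] e0 by blast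
    then show "\<rho> ` carrier G \<inter> U \<noteq> {}"
      using f(2) by blast
  qed
qed

end

section \<open>Transfer from the symplectic lattice to the surface\<close>

theorem theorem2:
  fixes S :: "'a topology" and \<mu> :: "'a chain set" and g :: nat
    and \<rho> :: "'a chain set \<Rightarrow> complex ^ 'n"
  assumes "closed_oriented_surface_of_genus S \<mu> g" and "g \<ge> 1"
    and "\<rho> \<in> rep_space S"
  shows "torus_topology closure_of (\<rho> ` carrier (homology_group 1 S)) = topspace torus_topology
     \<longleftrightarrow> rep_topology S closure_of (symplectic_orbit S \<mu> \<rho>) = topspace (rep_topology S)"
proof -
  obtain e where e: "symplectic_basis S \<mu> g e" and \<mu>: "\<mu> \<in> carrier (homology_group 2 S)"
    using assms(1) by (auto simp: closed_oriented_surface_of_genus_def has_genus_def fundamental_class_def)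
  have "symplectic_lattice (homology_group 1 S) (intersection_form S \<mu>) g e"
    using \<mu> assms(2) e by (intro symplectic_lattice_homology) auto
  then interpret symplectic_lattice "homology_group 1 S" "intersection_form S \<mu>" g e .
  have rep: "rep_space S = (Rep :: ('a chain set \<Rightarrow> complex ^ 'n) set)"
    by (simp add: rep_space_def Rep_def)
  have "rep_topology S = (Rep_topology :: ('a chain set \<Rightarrow> complex ^ 'n) topology)"
    by (simp add: rep_topology_def Rep_topology_def compact_open_topology_discrete rep)
  moreover have "symplectic_orbit S \<mu> \<rho> = Orbit \<rho>"
    by (simp add: symplectic_orbit_def symplectic_act_def Orbit_eq_inv symplectic_group_def Sp_def)
  ultimately show ?thesis
    using Orbit_dense_iff[of \<rho>] assms(3) by (simp add: rep)
qed

end
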